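(* Let $u$ be a convex function on the unit ball $B_1 \subset \mathbb{R}^n$ solving $\det D^2u \geq 1$ in $B_1$, and let $k$ be an integer with $0 < k < \frac{n}{2}$. If $u \in W^{2,p}(B_1)$ for some $p \geq \frac{n}{2k}(n-k)$, then the dimension of the set where $u$ agrees with a tangent plane is at most $k-1$; that is, for every point $x_0 \in B_1$ and every supporting affine function $l$ of $u$ at $x_0$ (i.e. $l \leq u$ in $B_1$ and $l(x_0) = u(x_0)$), the convex set $\{x \in B_1 : u(x) = l(x)\}$ has dimension at most $k-1$.
   Context: The inequality $\det D^2 u \geq 1$ for a convex function is understood in the weak (Alexandrov/viscosity) sense, i.e. the Monge–Ampère measure of $u$ is at least Lebesgue measure. The dimension of a convex set is the dimension of its affine hull. *)

theory Defs
  imports "HOL-Analysis.Analysis"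
begin

definition partial_deriv :: "'n::finite \<Rightarrow> (real^'n \<Rightarrow> real) \<Rightarrow> real^'n \<Rightarrow> real" where
  "partial_deriv i f x = frechet_derivative f (at x) (axis i 1)"

fun Ck :: "nat \<Rightarrow> (real^'n::finite \<Rightarrow> real) \<Rightarrow> bool" where
  "Ck 0 f = continuous_on UNIV f"
| "Ck (Suc k) f = (continuous_on UNIV f \<and> (\<forall>x. f differentiable (at x)) \<and>
      (\<forall>i. Ck k (partial_deriv i f)))"

definition smooth_fun :: "(real^'n::finite \<Rightarrow> real) \<Rightarrow> bool" where
  "smooth_fun f \<longleftrightarrow> (\<forall>k. Ck k f)"

definition test_fun :: "(real^'n::finite) set \<Rightarrow> (real^'n \<Rightarrow> real) \<Rightarrow> bool" where
  "test_fun U \<phi> \<longleftrightarrow> smooth_fun \<phi> \<and> compact (closure {x. \<phi> x \<noteq> 0})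
      \<and> closure {x. \<phi> x \<noteq> 0} \<subseteq> U"

definition Lp :: "real \<Rightarrow> (real^'n::finite) set \<Rightarrow> (real^'n \<Rightarrow> real) \<Rightarrow> bool" where
  "Lp p U f \<longleftrightarrow> f \<in> borel_measurable (lebesgue_on U)
      \<and> integrable (lebesgue_on U) (\<lambda>x. \<bar>f x\<bar> powr p)"

definition weak_partial :: "(real^'n::finite) set \<Rightarrow> 'n \<Rightarrow> (real^'n \<Rightarrow> real) \<Rightarrow> (real^'n \<Rightarrow> real) \<Rightarrow> bool" where
  "weak_partial U i f g \<longleftrightarrow>
     (\<forall>\<phi>. test_fun U \<phi> \<longrightarrow>
        integrable (lebesgue_on U) (\<lambda>x. f x * partial_deriv i \<phi> x) \<and>
        integrable (lebesgue_on U) (\<lambda>x. g x * \<phi> x) \<and>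
        (LINT x|lebesgue_on U. f x * partial_deriv i \<phi> x) = - (LINT x|lebesgue_on U. g x * \<phi> x))"

definition W2p :: "real \<Rightarrow> (real^'n::finite) set \<Rightarrow> (real^'n \<Rightarrow> real) \<Rightarrow> bool" where
  "W2p p U f \<longleftrightarrow> Lp p U f \<and>
     (\<exists>g h. (\<forall>i. weak_partial U i f (g i) \<and> Lp p U (g i)) \<and>
            (\<forall>i j. weak_partial U j (g i) (h i j) \<and> Lp p U (h i j)))"

definition subdiff :: "(real^'n::finite) set \<Rightarrow> (real^'n \<Rightarrow> real) \<Rightarrow> real^'n \<Rightarrow> (real^'n) set" where
  "subdiff U u x = {q. \<forall>y\<in>U. u x + q \<bullet> (y - x) \<le> u y}"

text \<open>det D^2 u \<ge> 1 in the Alexandrov sense: the Monge-Ampere measure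
  |\<partial>u(E)| dominates Lebesgue measure; by inner regularity it suffices to test compact E.\<close>
definition MA_ge_one :: "(real^'n::finite) set \<Rightarrow> (real^'n \<Rightarrow> real) \<Rightarrow> bool" where
  "MA_ge_one U u \<longleftrightarrow> (\<forall>K. compact K \<and> K \<subseteq> U \<longrightarrow>
      emeasure lebesgue K \<le> emeasure lebesgue (\<Union>x\<in>K. subdiff U u x))"

end

(* Suppose u agrees with the affine function l on a set of dimension at least k, and split
   R^n = Y + Z with Y a k-dimensional direction space of that set and dim Z = N = n - k.
   Put v = u - l >= 0; near a relative interior point v vanishes on Y.
   (1) On the box |y| < rho, |z| < r every subgradient of v is controlled by the integral J of v,
       so det D^2 u >= 1 forces J >= c r^(N + 2N/n).
   (2) v is convex along z and vanishes at z = 0, so v(y, s z) <= s v(y, z).  Integrating this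
       against a test function, changing variables and letting s -> 1 bounds
       c J / r^2 by the integral of D^2 u over the cylinder |y| < rho, |z| < r.
   (3) If D^2 u is in L^p with p >= n N / (2k), that integral is o(r^(N + 2N/n - 2)) as r -> 0,
       because the L^p mass of D^2 u on the shrinking cylinders tends to 0.
   The exponents in (1)-(3) match exactly, a contradiction. *)
theory Submission
  imports Defs "HOL-Computational_Algebra.Polynomial"
begin

section \<open>Smooth bump functions\<close>

text \<open>Formally, (2) is Euler's inequality z . grad v \<ge> v tested against a weight. Let Phi
  be a product of cutoffs in |y| and |z|, the second a function of 1 - |z|^2 / r^2. Its z-gradient
  is -2 z / r^2 times a nonnegative weight eta, so an integration by parts bounds the integral of v
  eta by r^2 / 2 times that of u against the z-Laplacian of Phi; the affine part integrates to zero
  against this Laplacian. The derivative of u in this argument is replaced by a derivative of the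
  dilated weight, and the two derivatives on Phi are then handed to the weak Hessian by its very
  definition. The exponents: T, the volume of a box of size r^N, satisfies J \<ge> c T^(1 + 2/n),
  and 2 - 2N/n = 2k/n because n = k + N. Hence the mean size of D^2 u on the cylinder is at least of
  order r^(-2k/n), and its p-th power times r^N stays away from 0 exactly when p \<ge> nN/(2k). At
  equality all powers of r cancel, so the contradiction has to come from absolute continuity of the
  integral of |D^2 u|^p, without any rate.\<close>

lemma frechet_derivative_sum_partial:
  fixes f :: "real^'n \<Rightarrow> real"
  assumes "f differentiable (at x)"
  shows "frechet_derivative f (at x) v = (\<Sum>i\<in>UNIV. v $ i * partial_deriv i f x)"
proof -
  interpret L: linear "frechet_derivative f (at x)"
    by (rule linear_frechet_derivative[OF assms])
  have "frechet_derivative f (at x) v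
      = frechet_derivative f (at x) (\<Sum>i\<in>UNIV. (v $ i) *\<^sub>R axis i 1)"
    using basis_expansion[of v] by (simp add: scalar_mult_eq_scaleR)
  also have "\<dots> = (\<Sum>i\<in>UNIV. v $ i * partial_deriv i f x)"
    by (simp add: L.sum L.scale partial_deriv_def)
  finally show ?thesis .
qed

lemma partial_deriv_eqI:
  assumes "(f has_derivative D) (at x)"
  shows "partial_deriv i f x = D (axis i 1)"
  using frechet_derivative_at[OF assms] by (simp add: partial_deriv_def)

lemma Ck_Suc_D: "Ck (Suc k) f \<Longrightarrow> Ck k f"
proof (induction k arbitrary: f)
  case (Suc k)
  then show ?case by (metis Ck.simps(2))
qed simp

lemma Ck_const: "Ck k (\<lambda>x. c)"
proof (induction k arbitrary: c)
  case (Suc k)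
  have "partial_deriv i (\<lambda>x. c) = (\<lambda>x::real^'a. 0)" for i
    by (rule ext, subst partial_deriv_eqI[of _ "\<lambda>_. 0"]) auto
  then show ?case using Suc by (simp add: continuous_on_const)
qed simp

lemma Ck_add: "Ck k f \<Longrightarrow> Ck k g \<Longrightarrow> Ck k (\<lambda>x. f x + g x)"
proof (induction k arbitrary: f g)
  case (Suc k)
  have d: "f differentiable (at x)" "g differentiable (at x)" for x using Suc by auto
  have "partial_deriv i (\<lambda>x. f x + g x) = (\<lambda>x. partial_deriv i f x + partial_deriv i g x)" for i
    using frechet_derivative_works[THEN iffD1, OF d(1)] frechet_derivative_works[THEN iffD1, OF d(2)]
    by (intro ext, subst partial_deriv_eqI[OF has_derivative_add]) (auto simp: partial_deriv_def)
  then show ?case using Suc d by (auto intro: continuous_on_add)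
qed (auto intro: continuous_on_add)

lemma Ck_mult: "Ck k f \<Longrightarrow> Ck k g \<Longrightarrow> Ck k (\<lambda>x. f x * g x)"
proof (induction k arbitrary: f g)
  case (Suc k)
  have d: "f differentiable (at x)" "g differentiable (at x)" for x using Suc by auto
  have "partial_deriv i (\<lambda>x. f x * g x)
      = (\<lambda>x. f x * partial_deriv i g x + partial_deriv i f x * g x)" for i
    using frechet_derivative_works[THEN iffD1, OF d(1)] frechet_derivative_works[THEN iffD1, OF d(2)]
    by (intro ext, subst partial_deriv_eqI[OF has_derivative_mult]) (auto simp: partial_deriv_def)
  moreover have "Ck k f" "Ck k g" using Suc.prems Ck_Suc_D by blast+
  ultimately show ?case using Suc d by (auto intro!: continuous_on_mult Ck_add)
qed (auto intro: continuous_on_mult)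

lemma Ck_sum: "(\<And>i. i \<in> S \<Longrightarrow> Ck k (f i)) \<Longrightarrow> Ck k (\<lambda>x. \<Sum>i\<in>S. f i x)"
  by (induction S rule: infinite_finite_induct) (auto intro: Ck_const Ck_add)

lemma Ck_inner: "Ck k (\<lambda>x. b \<bullet> x)"
proof (cases k)
  case (Suc m)
  have "((\<lambda>x. b \<bullet> x) has_derivative (\<lambda>h. b \<bullet> h)) (at x)" for x
    by (auto intro!: derivative_eq_intros)
  then have "partial_deriv i (\<lambda>x. b \<bullet> x) = (\<lambda>x. b \<bullet> axis i 1)" for i
    by (intro ext) (rule partial_deriv_eqI)
  then show ?thesis using Suc by (auto simp: Ck_const intro!: continuous_intros)
qed (auto intro!: continuous_intros)

text \<open>The outer function comes with its whole sequence of successive derivatives: the chain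
  rule passes from \<open>g m\<close> to \<open>g (Suc m)\<close>, so the induction on
  \<open>k\<close> has to run for all \<open>m\<close> at once.\<close>

lemma Ck_compose:
  fixes g :: "nat \<Rightarrow> real \<Rightarrow> real"
  assumes "\<And>m t. (g m has_real_derivative g (Suc m) t) (at t)" and "Ck k f"
  shows "Ck k (\<lambda>x. g m (f x))"
  using assms(2)
proof (induction k arbitrary: m f)
  case 0
  have "continuous_on UNIV (g m)"
    using assms(1) by (meson DERIV_isCont continuous_at_imp_continuous_on)
  with 0 show ?case by (auto intro: continuous_on_compose2)
next
  case (Suc k)
  have c: "continuous_on UNIV (g m)"
    using assms(1) by (meson DERIV_isCont continuous_at_imp_continuous_on)
  have D: "((\<lambda>x. g m (f x)) has_derivative (\<lambda>h. frechet_derivative f (at x) h * g (Suc m) (f x))) (at x)" for x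
    using Suc.prems frechet_derivative_works
    by (auto intro!: DERIV_compose_FDERIV[OF assms(1)])
  then have "partial_deriv i (\<lambda>x. g m (f x)) = (\<lambda>x. partial_deriv i f x * g (Suc m) (f x))" for i
    by (intro ext, subst partial_deriv_eqI[OF D]) (auto simp: partial_deriv_def)
  moreover have "Ck k f" using Suc.prems Ck_Suc_D by blast
  moreover have "continuous_on UNIV (\<lambda>x. g m (f x))"
    using c Suc.prems by (auto intro: continuous_on_compose2)
  moreover have "(\<lambda>x. g m (f x)) differentiable (at x)" for x
    using D[of x] unfolding differentiable_def by blast
  ultimately show ?case using Suc by (auto intro!: Ck_mult)
qed

fun bump_poly :: "nat \<Rightarrow> real poly" where
  "bump_poly 0 = 1"
| "bump_poly (Suc m) = [:0, 0, 1:] * (bump_poly m - pderiv (bump_poly m))"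

text \<open>The \<open>m\<close>-th derivative of \<open>exp (- 1 / t)\<close>, extended by zero to \<open>t \<le> 0\<close>; the recursion for
  \<^const>\<open>bump_poly\<close> is the chain rule in the variable \<open>1 / t\<close>.\<close>

definition bump :: "nat \<Rightarrow> real \<Rightarrow> real" where
  "bump m t = (if t > 0 then poly (bump_poly m) (1 / t) * exp (- (1 / t)) else 0)"

text \<open>The free power \<open>x ^ k\<close> closes the induction: in the Horner form a + x q the
  factor x is absorbed by raising \<open>k\<close>.\<close>

lemma poly_exp_tendsto_0: "((\<lambda>x::real. x ^ k * (poly q x * exp (- x))) \<longlongrightarrow> 0) at_top"
proof (induction q arbitrary: k)
  case (pCons a q)
  have "((\<lambda>x. a * (x ^ k / exp x) + x ^ Suc k * (poly q x * exp (-x))) \<longlongrightarrow> a * 0 + 0) at_top"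
    using pCons.IH[of "Suc k"] tendsto_power_div_exp_0[of k] by (intro tendsto_intros)
  then show ?case by (simp add: exp_minus field_simps)
qed simp

lemma bump_derivative: "(bump m has_real_derivative bump (Suc m) t) (at t)"
proof -
  consider "t > 0" | "t < 0" | "t = 0" by linarith
  then show ?thesis
  proof cases
    case 1
    have "((\<lambda>t. poly (bump_poly m) (1 / t) * exp (- (1 / t))) has_real_derivative bump (Suc m) t) (at t)"
      using 1 by (auto intro!: derivative_eq_intros DERIV_chain2[OF poly_DERIV]
          simp: bump_def power2_eq_square field_simps)
    then show ?thesis
      by (rule has_field_derivative_transform_within_open[where S="{0<..}"]) (use 1 in \<open>auto simp: bump_def\<close>)
  next
    case 2
    have "((\<lambda>t. 0) has_real_derivative bump (Suc m) t) (at t)" using 2 by (simp add: bump_def)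
    then show ?thesis
      by (rule has_field_derivative_transform_within_open[where S="{..<0}"]) (use 2 in \<open>auto simp: bump_def\<close>)
  next
    case 3
    have "((\<lambda>y. bump m y / y) \<longlongrightarrow> 0) (at 0)"
    proof (rule filterlim_split_at_real)
      show "((\<lambda>y. bump m y / y) \<longlongrightarrow> 0) (at_left 0)"
        by (rule tendsto_eventually) (auto simp: bump_def eventually_at_filter)
      \<comment> \<open>With x = 1/y the quotient \<open>bump m y / y\<close> is x times a
        polynomial in x times exp(-x), hence the exponent 1.\<close>
      have "((\<lambda>y. inverse y ^ 1 * (poly (bump_poly m) (inverse y) * exp (- inverse y))) \<longlongrightarrow> 0) (at_right 0)"
        using filterlim_compose[OF poly_exp_tendsto_0 filterlim_inverse_at_top_right] .
      then show "((\<lambda>y. bump m y / y) \<longlongrightarrow> 0) (at_right 0)"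
        by (rule Lim_transform_eventually) (auto simp: bump_def eventually_at_filter field_simps)
    qed
    then show ?thesis using 3 by (auto simp: has_field_derivative_iff bump_def)
  qed
qed

lemma isCont_bump: "isCont (bump m) t"
  using bump_derivative DERIV_isCont by blast

lemma bump_continuous [continuous_intros]:
  "continuous_on S f \<Longrightarrow> continuous_on S (\<lambda>x. bump m (f x))"
  using isCont_bump continuous_at_imp_continuous_on continuous_on_compose2 by (metis subset_UNIV)

lemma bump_eq_0: "t \<le> 0 \<Longrightarrow> bump m t = 0"
  by (simp add: bump_def)

lemma bump_0_nonneg: "bump 0 t \<ge> 0"
  by (simp add: bump_def)

lemma bump_0_le_1: "bump 0 t \<le> 1"
  by (simp add: bump_def)

lemma bump_1_pos: "t > 0 \<Longrightarrow> bump 1 t > 0"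
  by (simp add: bump_def pderiv_1)

lemma bump_1_nonneg: "bump 1 t \<ge> 0"
  using bump_1_pos[of t] bump_eq_0[of t 1] by (cases "t > 0") auto

section \<open>Isometries and partial dilations of Lebesgue measure\<close>

lemma nn_integral_lborel_translate:
  fixes f :: "'a::euclidean_space \<Rightarrow> ennreal"
  assumes [measurable]: "f \<in> borel_measurable borel"
  shows "(\<integral>\<^sup>+x. f (c + x) \<partial>lborel) = (\<integral>\<^sup>+x. f x \<partial>lborel)"
proof -
  have "(\<integral>\<^sup>+x. f x \<partial>lborel) = (\<integral>\<^sup>+x. f x \<partial>distr lborel borel ((+) c))"
    by (simp add: lborel_distr_plus)
  also have "\<dots> = (\<integral>\<^sup>+x. f (c + x) \<partial>lborel)"
    by (subst nn_integral_distr) auto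
  finally show ?thesis by simp
qed

lemma continuous_on_orthogonal_transformation:
  fixes Q :: "'a::euclidean_space \<Rightarrow> 'a"
  shows "orthogonal_transformation Q \<Longrightarrow> continuous_on S Q"
  by (meson linear_continuous_on linear_conv_bounded_linear orthogonal_transformation_linear)

lemma borel_measurable_orthogonal_transformation:
  fixes Q :: "'a::euclidean_space \<Rightarrow> 'a"
  shows "orthogonal_transformation Q \<Longrightarrow> Q \<in> borel_measurable borel"
  by (intro borel_measurable_continuous_onI continuous_on_orthogonal_transformation)

text \<open>Uniqueness of translation-invariant measures: by Fubini, both sides have the same product with the
  volume of the unit ball. The change-of-variables theorems of HOL-Analysis need a well-ordered index type.\<close>

lemma lborel_distr_orthogonal:
  fixes Q :: "'a::euclidean_space \<Rightarrow> 'a"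
  assumes Q: "orthogonal_transformation Q"
  shows "distr lborel borel Q = lborel"
proof (rule measure_eqI)
  interpret Q: linear Q using Q by (rule orthogonal_transformation_linear)
  have Qm[measurable]: "Q \<in> borel_measurable borel"
    by (rule borel_measurable_orthogonal_transformation[OF Q])
  fix A :: "'a set" assume "A \<in> sets (distr lborel borel Q)"
  then have [measurable]: "A \<in> sets borel" by simp
  define B where "B = ball (0::'a) 1"
  have [measurable]: "B \<in> sets borel" by (simp add: B_def)
  let ?b = "indicator B :: 'a \<Rightarrow> ennreal" and ?a = "indicator A :: 'a \<Rightarrow> ennreal"
  \<comment> \<open>Invariance of the unit ball under \<open>Q\<close> is what fixes the constant of
    proportionality between the two measures to 1.\<close>
  have QB: "?b (Q y) = ?b y" for y
    using orthogonal_transformation_norm[OF Q, of y] by (simp add: indicator_def B_def)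
  have tr: "(\<integral>\<^sup>+y. ?b (Q y - x) * ?a (Q y) \<partial>lborel) = (\<integral>\<^sup>+y. ?b (Q y) * ?a (x + Q y) \<partial>lborel)" for x
  proof -
    have [measurable]: "(\<lambda>y. ?b (Q y - x) * ?a (Q y)) \<in> borel_measurable borel"
      by measurable
    obtain z where z: "x = Q z" using orthogonal_transformation_surj[OF Q] by (metis surjD)
    have "(\<integral>\<^sup>+y. ?b (Q y) * ?a (x + Q y) \<partial>lborel)
        = (\<integral>\<^sup>+y. (\<lambda>y. ?b (Q y - x) * ?a (Q y)) (z + y) \<partial>lborel)"
      by (simp add: z Q.add)
    also have "\<dots> = (\<integral>\<^sup>+y. ?b (Q y - x) * ?a (Q y) \<partial>lborel)"
      by (rule nn_integral_lborel_translate) fact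
    finally show ?thesis by simp
  qed
  have bx: "(\<integral>\<^sup>+x. ?b (y - x) \<partial>lborel) = emeasure lborel B" for y
  proof -
    have "(\<integral>\<^sup>+x. ?b (y - x) \<partial>lborel) = (\<integral>\<^sup>+x. ?b (-y + x) \<partial>lborel)"
      by (rule nn_integral_cong) (auto simp: B_def indicator_def norm_minus_commute)
    also have "\<dots> = (\<integral>\<^sup>+x. ?b x \<partial>lborel)"
      by (rule nn_integral_lborel_translate) measurable
    finally show ?thesis by simp
  qed
  have "emeasure lborel B * emeasure lborel A
      = (\<integral>\<^sup>+y. ?b (Q y) * (\<integral>\<^sup>+x. ?a x \<partial>lborel) \<partial>lborel)"
    by (simp add: QB nn_integral_multc)
  also have "\<dots> = (\<integral>\<^sup>+y. ?b (Q y) * (\<integral>\<^sup>+x. ?a (Q y + x) \<partial>lborel) \<partial>lborel)"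
    by (subst nn_integral_lborel_translate) auto
  also have "\<dots> = (\<integral>\<^sup>+y. (\<integral>\<^sup>+x. ?b (Q y) * ?a (x + Q y) \<partial>lborel) \<partial>lborel)"
    by (subst nn_integral_cmult) (auto simp: add.commute)
  also have "\<dots> = (\<integral>\<^sup>+x. (\<integral>\<^sup>+y. ?b (Q y) * ?a (x + Q y) \<partial>lborel) \<partial>lborel)"
    by (rule lborel_pair.Fubini') measurable
  also have "\<dots> = (\<integral>\<^sup>+x. (\<integral>\<^sup>+y. ?b (Q y - x) * ?a (Q y) \<partial>lborel) \<partial>lborel)"
    by (simp add: tr)
  also have "\<dots> = (\<integral>\<^sup>+y. (\<integral>\<^sup>+x. ?b (Q y - x) * ?a (Q y) \<partial>lborel) \<partial>lborel)"
    by (rule lborel_pair.Fubini') measurable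
  also have "\<dots> = (\<integral>\<^sup>+y. emeasure lborel B * ?a (Q y) \<partial>lborel)"
    by (intro nn_integral_cong, subst nn_integral_multc) (auto simp: bx)
  also have "\<dots> = emeasure lborel B * (\<integral>\<^sup>+y. ?a (Q y) \<partial>lborel)"
    by (rule nn_integral_cmult) measurable
  also have "(\<integral>\<^sup>+y. ?a (Q y) \<partial>lborel) = emeasure (distr lborel borel Q) A"
    using nn_integral_distr[of Q lborel borel ?a] by simp
  finally have "emeasure lborel B * emeasure lborel A = emeasure lborel B * emeasure (distr lborel borel Q) A" .
  moreover have "emeasure lborel B \<noteq> 0" "emeasure lborel B \<noteq> \<infinity>"
    using emeasure_lborel_ball_finite[of "0::'a" 1] content_ball_pos[of 1 "0::'a"]
    by (auto simp: measure_def B_def)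
  ultimately show "emeasure (distr lborel borel Q) A = emeasure lborel A"
    by (simp add: ennreal_mult_cancel_left)
qed simp

lemma lborel_distr_isometry:
  fixes Q :: "'a::euclidean_space \<Rightarrow> 'a"
  assumes Q: "orthogonal_transformation Q"
  shows "distr lborel borel (\<lambda>x. c + Q x) = lborel"
proof -
  have [measurable]: "Q \<in> borel_measurable borel"
    by (rule borel_measurable_orthogonal_transformation[OF Q])
  have "distr (distr lborel borel Q) borel ((+) c) = distr lborel borel (\<lambda>x. c + Q x)"
    by (subst distr_distr) (auto simp: o_def)
  then show ?thesis by (simp add: lborel_distr_orthogonal[OF Q] lborel_distr_plus)
qed

section \<open>Dilations that fix the coordinates in a given index set\<close>

definition dil :: "'n set \<Rightarrow> real \<Rightarrow> real^'n \<Rightarrow> real^'n" where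
  "dil I s x = (\<chi> i. if i \<in> I then x $ i else s * x $ i)"

lemma dil_nth: "dil I s x $ i = (if i \<in> I then x $ i else s * x $ i)"
  by (simp add: dil_def)

lemma continuous_on_dil [continuous_intros]: "continuous_on S (dil I s)"
  unfolding dil_def
proof (intro continuous_on_vec_lambda)
  show "continuous_on S (\<lambda>x. if i \<in> I then x $ i else s * x $ i)" for i
    by (cases "i \<in> I") (auto intro!: continuous_intros)
qed

lemma borel_measurable_dil [measurable]: "dil I s \<in> borel_measurable borel"
  by (intro borel_measurable_continuous_onI continuous_intros)

lemma integral_dil:
  fixes f :: "real^'n \<Rightarrow> real"
  assumes [measurable]: "f \<in> borel_measurable borel" and s: "s \<noteq> 0"
  shows "integral\<^sup>L lborel f = \<bar>s\<bar> ^ card (- I) * (\<integral>x. f (dil I s x) \<partial>lborel)"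
proof -
  define c :: "real^'n \<Rightarrow> real" where "c b = (if \<exists>i\<in>I. b = axis i 1 then 1 else s)" for b
  have c: "c (axis i 1) = (if i \<in> I then 1 else s)" for i
    by (auto simp: c_def axis_eq_axis)
  have T: "0 + (\<Sum>j\<in>Basis. (c j * (x \<bullet> j)) *\<^sub>R j) = dil I s x" for x
  proof -
    have "(\<Sum>j\<in>Basis. (c j * (x \<bullet> j)) *\<^sub>R j) \<bullet> axis i 1 = dil I s x \<bullet> axis i 1" for i
    proof -
      have "(\<Sum>j\<in>Basis. (c j * (x \<bullet> j)) *\<^sub>R j) \<bullet> axis i 1 = c (axis i 1) * (x \<bullet> axis i 1)"
        by (rule inner_sum_left_Basis) (simp add: axis_in_Basis_iff)
      then show ?thesis by (simp add: inner_axis c dil_nth)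
    qed
    then show ?thesis by (simp add: inner_axis vec_eq_iff)
  qed
  have P: "(\<Prod>j\<in>Basis. \<bar>c j\<bar>) = \<bar>s\<bar> ^ card (- I)"
  proof -
    have "(\<Prod>j\<in>Basis. \<bar>c j\<bar>) = (\<Prod>i\<in>UNIV. \<bar>c (axis i 1)\<bar>)"
      by (rule prod.reindex_cong[where l="\<lambda>i. axis i 1"])
         (auto simp: inj_on_def axis_eq_axis Basis_vec_def)
    also have "\<dots> = (\<Prod>i\<in>UNIV. if i \<in> I then 1 else \<bar>s\<bar>)"
      by (intro prod.cong) (auto simp: c)
    also have "\<dots> = \<bar>s\<bar> ^ card (- I)"
      by (simp add: prod.If_cases)
    finally show ?thesis .
  qed
  have "integral\<^sup>L lborel f = (\<integral>x. f x \<partial>density (distr lborel borel (dil I s)) (\<lambda>_. \<Prod>j\<in>Basis. \<bar>c j\<bar>))"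
    using lborel_affine_euclidean[of c 0] s unfolding T by (auto simp: c_def)
  also have "\<dots> = \<bar>s\<bar> ^ card (- I) * (\<integral>x. f (dil I s x) \<partial>lborel)"
    unfolding P by (simp add: integral_density integral_distr)
  finally show ?thesis .
qed

section \<open>Dilation inequality on cylinders\<close>

text \<open>A defining function: composed with \<open>bump m\<close>, it gives a smooth cutoff to
  the region where the \<open>I\<close>-coordinates have norm below \<open>r\<close>.\<close>

definition cylfun :: "'n set \<Rightarrow> real \<Rightarrow> real^'n \<Rightarrow> real" where
  "cylfun I r x = 1 - (\<Sum>i\<in>I. (x $ i)\<^sup>2) / r\<^sup>2"

lemma cylfun_le_1: "cylfun I r x \<le> 1"
  by (simp add: cylfun_def sum_nonneg)

lemma continuous_on_cylfun [continuous_intros]: "continuous_on S (cylfun I r)"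
  unfolding cylfun_def divide_inverse by (intro continuous_intros)

lemma borel_measurable_cylfun [measurable]: "cylfun I r \<in> borel_measurable borel"
  by (intro borel_measurable_continuous_onI continuous_intros)

lemma borel_measurable_bump [measurable]: "bump m \<in> borel_measurable borel"
  by (intro borel_measurable_continuous_onI continuous_at_imp_continuous_on ballI isCont_bump)

lemma cylfun_dil_same [simp]: "cylfun I r (dil I s x) = cylfun I r x"
  by (simp add: cylfun_def dil_nth)

lemma cylfun_dil_compl: "cylfun (- I) r (dil I s x) = 1 - s\<^sup>2 * (1 - cylfun (- I) r x)"
  by (simp add: cylfun_def dil_nth power_mult_distrib sum_distrib_left[symmetric])

definition cylinder :: "'n set \<Rightarrow> real \<Rightarrow> real \<Rightarrow> (real^'n) set" where
  "cylinder I \<rho> r = {x. cylfun I \<rho> x \<ge> 0 \<and> cylfun (- I) r x \<ge> 0}"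

lemma closed_cylinder: "closed (cylinder I \<rho> r)"
  unfolding cylinder_def by (intro closed_Collect_conj closed_Collect_le continuous_intros)

lemma cylinder_nth_le:
  assumes "x \<in> cylinder I \<rho> r" "\<rho> > 0" "r > 0"
  shows "\<bar>x $ i\<bar> \<le> (if i \<in> I then \<rho> else r)"
proof -
  have *: "\<bar>x $ i\<bar> \<le> t" if "cylfun J t x \<ge> 0" "i \<in> J" "t > 0" for J t
  proof -
    have "(x $ i)\<^sup>2 \<le> (\<Sum>i\<in>J. (x $ i)\<^sup>2)" using that(2) by (intro member_le_sum) auto
    also have "\<dots> \<le> t\<^sup>2" using that by (simp add: cylfun_def field_simps)
    finally show ?thesis using that by (simp add: abs_le_square_iff[symmetric])
  qed
  show ?thesis using assms *[of I \<rho>] *[of "-I" r] by (auto simp: cylinder_def)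
qed

lemma cylinder_subset_cbox:
  assumes "\<rho> > 0" "r > 0"
  shows "cylinder I \<rho> r \<subseteq> cbox (\<chi> i. - (if i \<in> I then \<rho> else r)) (\<chi> i. if i \<in> I then \<rho> else r)"
proof
  fix x assume "x \<in> cylinder I \<rho> r"
  from cylinder_nth_le[OF this assms]
  show "x \<in> cbox (\<chi> i. - (if i \<in> I then \<rho> else r)) (\<chi> i. if i \<in> I then \<rho> else r)"
    unfolding mem_box_cart vec_lambda_beta by (simp add: abs_le_iff minus_le_iff)
qed

lemma compact_cylinder: "\<rho> > 0 \<Longrightarrow> r > 0 \<Longrightarrow> compact (cylinder I \<rho> r)"
  by (meson bounded_cbox bounded_subset closed_cylinder compact_eq_bounded_closed cylinder_subset_cbox)

lemma cylinder_borel [measurable]: "cylinder I \<rho> r \<in> sets borel"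
  by (intro borel_closed closed_cylinder)

lemma cylinder_norm_le:
  assumes "x \<in> cylinder I \<rho> r" "\<rho> > 0" "r > 0" "r \<le> \<rho>"
  shows "norm x \<le> 2 * \<rho>"
proof -
  have "(norm x)\<^sup>2 = (\<Sum>i\<in>I. (x $ i)\<^sup>2) + (\<Sum>i\<in>-I. (x $ i)\<^sup>2)"
    by (simp add: norm_vec_def L2_set_def sum_nonneg sum.union_disjoint[symmetric] Compl_partition)
  also have "\<dots> \<le> \<rho>\<^sup>2 + r\<^sup>2"
    using assms by (intro add_mono) (auto simp: cylinder_def cylfun_def field_simps)
  also have "\<dots> \<le> (2 * \<rho>)\<^sup>2"
  proof -
    have "r\<^sup>2 \<le> \<rho>\<^sup>2" using assms by (intro power_mono) auto
    moreover have "0 \<le> \<rho>\<^sup>2" by simp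
    ultimately have "r\<^sup>2 \<le> 3 * \<rho>\<^sup>2" by linarith
    then show ?thesis by (simp add: power_mult_distrib)
  qed
  finally show ?thesis by (rule power2_le_imp_le) (use assms in auto)
qed

lemma dil_cylinder:
  assumes "x \<in> cylinder I \<rho> r" "0 \<le> s" "s \<le> 1"
  shows "dil I s x \<in> cylinder I \<rho> r"
proof -
  have "s\<^sup>2 * (1 - cylfun (- I) r x) \<le> 1 * 1"
    using assms by (intro mult_mono) (auto simp: power_le_one cylfun_le_1 cylinder_def)
  then show ?thesis using assms by (simp add: cylinder_def cylfun_dil_compl)
qed

lemma integrable_bounded_cylinder:
  fixes f :: "real^'n \<Rightarrow> real"
  assumes "\<rho> > 0" "r > 0" and m: "f \<in> borel_measurable borel"
    and b: "\<And>x. x \<in> cylinder I \<rho> r \<Longrightarrow> \<bar>f x\<bar> \<le> C" and z: "\<And>x. x \<notin> cylinder I \<rho> r \<Longrightarrow> f x = 0"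
  shows "integrable lborel f"
proof (rule integrableI_bounded_set[where A="cylinder I \<rho> r" and B=C])
  show "emeasure lborel (cylinder I \<rho> r) < \<infinity>"
    using compact_cylinder[OF assms(1,2)] emeasure_compact_finite by blast
qed (use assms in auto)

lemma bump_product_zero:
  assumes "x \<notin> cylinder I \<rho> r"
  shows "bump m (cylfun I \<rho> x) * bump l (cylfun (- I) r x) = 0"
  using assms by (auto simp: cylinder_def bump_eq_0)

text \<open>The lower end -3 is the least value of \<open>1 - \<sigma>\<^sup>2 * z\<close> for
  \<sigma> between 1 and 2 and z between 0 and 1, the range met by the dilated weights.\<close>

lemma bump_bounded:
  obtains C where "C > 0" "\<And>t. - 3 \<le> t \<Longrightarrow> t \<le> 1 \<Longrightarrow> \<bar>bump m t\<bar> \<le> C"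
proof -
  have "compact (bump m ` {-3..1})"
    by (intro compact_continuous_image continuous_at_imp_continuous_on ballI isCont_bump) auto
  then obtain C where "C > 0" "\<forall>y\<in>bump m ` {-3..1}. norm y \<le> C"
    by (meson bounded_pos compact_imp_bounded)
  then show ?thesis by (intro that[of C]) auto
qed

text \<open>With \<open>z = \<bar>Z\<bar>\<^sup>2 / r\<^sup>2\<close>, the \<open>Z\<close>-part of the weight of \<open>dilation_inequality\<close>, dilated by \<open>\<sigma>\<close> and multiplied by
  \<open>\<sigma> ^ (N + 1)\<close>. Its derivative at \<open>\<sigma> = 1\<close> is the weight on the left of that inequality minus the one on the right.\<close>

definition scale_prof :: "nat \<Rightarrow> real \<Rightarrow> real \<Rightarrow> real" where
  "scale_prof N z \<sigma> = \<sigma> ^ Suc N * bump 1 (1 - \<sigma>\<^sup>2 * z)"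

definition scale_prof' :: "nat \<Rightarrow> real \<Rightarrow> real \<Rightarrow> real" where
  "scale_prof' N z \<sigma> = real (Suc N) * \<sigma> ^ N * bump 1 (1 - \<sigma>\<^sup>2 * z)
     - \<sigma> ^ Suc N * (bump 2 (1 - \<sigma>\<^sup>2 * z) * (2 * \<sigma> * z))"

lemma scale_prof_deriv: "(scale_prof N z has_real_derivative scale_prof' N z \<sigma>) (at \<sigma>)"
  unfolding scale_prof_def[abs_def] scale_prof'_def
  by (rule derivative_eq_intros DERIV_chain2[OF bump_derivative] refl)+
    (simp add: numeral_2_eq_2 algebra_simps)

text \<open>Supplies the dominating constant for the difference quotients at \<sigma> = 1; the mean
  value theorem reduces it to a bound on \<open>scale_prof'\<close>.\<close>

lemma scale_prof_lipschitz:
  obtains C where "C > 0"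
    "\<And>z \<sigma>. 0 \<le> z \<Longrightarrow> z \<le> 1 \<Longrightarrow> 1 < \<sigma> \<Longrightarrow> \<sigma> \<le> 2 \<Longrightarrow>
       \<bar>(scale_prof N z \<sigma> - scale_prof N z 1) / (\<sigma> - 1)\<bar> \<le> C"
proof -
  obtain C1 where C1: "C1 > 0" "\<And>t. - 3 \<le> t \<Longrightarrow> t \<le> 1 \<Longrightarrow> \<bar>bump 1 t\<bar> \<le> C1"
    using bump_bounded by blast
  obtain C2 where C2: "C2 > 0" "\<And>t. - 3 \<le> t \<Longrightarrow> t \<le> 1 \<Longrightarrow> \<bar>bump 2 t\<bar> \<le> C2"
    using bump_bounded by blast
  define C where "C = real (Suc N) * 2 ^ N * C1 + 2 ^ Suc N * (C2 * (2 * 2 * 1))"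
  have b: "\<bar>scale_prof' N z t\<bar> \<le> C" if z: "0 \<le> z" "z \<le> 1" and t: "1 \<le> t" "t \<le> 2" for z t
  proof -
    have "t\<^sup>2 * z \<le> 2\<^sup>2 * 1" using z t by (intro mult_mono power_mono) auto
    then have r: "- 3 \<le> 1 - t\<^sup>2 * z" "1 - t\<^sup>2 * z \<le> 1" using z by auto
    have "\<bar>scale_prof' N z t\<bar> \<le> \<bar>real (Suc N) * t ^ N * bump 1 (1 - t\<^sup>2 * z)\<bar>
        + \<bar>t ^ Suc N * (bump 2 (1 - t\<^sup>2 * z) * (2 * t * z))\<bar>"
      unfolding scale_prof'_def by (rule abs_triangle_ineq4)
    also have "\<dots> = real (Suc N) * t ^ N * \<bar>bump 1 (1 - t\<^sup>2 * z)\<bar>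
        + t ^ Suc N * (\<bar>bump 2 (1 - t\<^sup>2 * z)\<bar> * (2 * t * z))"
      using z t by (simp add: abs_mult)
    also have "\<dots> \<le> C" unfolding C_def
      using z t r C1 C2 by (intro add_mono mult_mono power_mono) auto
    finally show ?thesis .
  qed
  have "C > 0" unfolding C_def using C1 C2 by (intro add_pos_pos) auto
  moreover have "\<bar>(scale_prof N z \<sigma> - scale_prof N z 1) / (\<sigma> - 1)\<bar> \<le> C"
    if z: "0 \<le> z" "z \<le> 1" and s: "1 < \<sigma>" "\<sigma> \<le> 2" for z \<sigma>
  proof -
    obtain t where t: "1 < t" "t < \<sigma>" "scale_prof N z \<sigma> - scale_prof N z 1 = (\<sigma> - 1) * scale_prof' N z t"
      using MVT2[OF s(1), of "scale_prof N z" "scale_prof' N z"] scale_prof_deriv by blast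
    then show ?thesis using b[OF z, of t] s by simp
  qed
  ultimately show ?thesis using that by blast
qed

text \<open>By the last hypothesis, v = f - (w . x + d) satisfies v(y, s z) \<le> s v(y, z) on the
  cylinder, whose infinitesimal form is z . grad v \<ge> v. A change of variables puts the dilation
  on the weight, so that only the weight is differentiated at s = 1. The weight on the right is r^2
  / 2 times the Laplacian, in the coordinates outside \<open>I\<close>, of the product of the two
  \<open>bump 0\<close> cutoffs.\<close>

lemma dilation_inequality:
  fixes f :: "real^'n \<Rightarrow> real" and I :: "'n set"
  defines "N \<equiv> card (- I)"
  assumes \<rho>: "\<rho> > 0" and r: "r > 0"
    and fm[measurable]: "f \<in> borel_measurable borel"
    and fb: "\<And>x. \<bar>f x\<bar> \<le> M"
    and fz: "\<And>x. x \<notin> cylinder I \<rho> r \<Longrightarrow> f x = 0"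
    and fc: "\<And>x s. x \<in> cylinder I \<rho> r \<Longrightarrow> 0 < s \<Longrightarrow> s < 1 \<Longrightarrow>
        f (dil I s x) \<le> s * f x + (1 - s) * (w \<bullet> dil I 0 x + d)"
  shows "(\<integral>x. (f x - (w \<bullet> x + d)) * (bump 0 (cylfun I \<rho> x) * bump 1 (cylfun (-I) r x)) \<partial>lborel)
    \<le> (\<integral>x. f x * (bump 0 (cylfun I \<rho> x) * (2 * (1 - cylfun (-I) r x) * bump 2 (cylfun (-I) r x)
           - real N * bump 1 (cylfun (-I) r x))) \<partial>lborel)"
proof -
  define \<theta> where "\<theta> x = bump 0 (cylfun I \<rho> x)" for x
  define \<zeta> where "\<zeta> x = 1 - cylfun (-I) r x" for x
  define \<eta> where "\<eta> x = \<theta> x * bump 1 (cylfun (-I) r x)" for x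
  have [measurable]: "\<theta> \<in> borel_measurable borel" "\<zeta> \<in> borel_measurable borel" "\<eta> \<in> borel_measurable borel"
    unfolding \<theta>_def[abs_def] \<zeta>_def[abs_def] \<eta>_def[abs_def] by measurable
  let ?E = "cylinder I \<rho> r"
  have \<zeta>: "0 \<le> \<zeta> x" "x \<in> ?E \<Longrightarrow> \<zeta> x \<le> 1" for x
    using cylfun_le_1[of "-I" r x] by (auto simp: \<zeta>_def cylinder_def)
  have \<theta>: "0 \<le> \<theta> x" "\<theta> x \<le> 1" for x by (simp_all add: \<theta>_def bump_0_nonneg bump_0_le_1)
  obtain C1 where C1: "C1 > 0" "\<And>t. - 3 \<le> t \<Longrightarrow> t \<le> 1 \<Longrightarrow> \<bar>bump 1 t\<bar> \<le> C1"
    using bump_bounded by blast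
  have \<eta>0: "0 \<le> \<eta> x" for x using \<theta> bump_1_nonneg by (simp add: \<eta>_def)
  have \<eta>z: "\<eta> x = 0" if "x \<notin> ?E" for x
    using bump_product_zero[OF that] by (simp add: \<eta>_def \<theta>_def)
  have \<eta>b: "\<bar>\<eta> x\<bar> \<le> C1" for x
  proof (cases "x \<in> ?E")
    case True
    then have "\<bar>bump 1 (cylfun (-I) r x)\<bar> \<le> C1" by (intro C1) (auto simp: cylinder_def cylfun_le_1)
    with \<theta>[of x] have "\<bar>\<theta> x\<bar> * \<bar>bump 1 (cylfun (-I) r x)\<bar> \<le> 1 * C1" by (intro mult_mono) auto
    then show ?thesis by (simp add: \<eta>_def abs_mult)
  qed (use \<eta>z C1 in auto)
  have M0: "M \<ge> 0" using fb[of 0] by linarith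
  have int: "integrable lborel (\<lambda>x. g x * \<eta> x)"
    if [measurable]: "g \<in> borel_measurable borel" and "\<And>x. x \<in> ?E \<Longrightarrow> \<bar>g x\<bar> \<le> K" for g K
  proof (rule integrable_bounded_cylinder[OF \<rho> r, where C="\<bar>K\<bar> * C1"])
    show "\<bar>g x * \<eta> x\<bar> \<le> \<bar>K\<bar> * C1" if "x \<in> ?E" for x
      using that \<open>\<And>x. x \<in> ?E \<Longrightarrow> \<bar>g x\<bar> \<le> K\<close>[of x] \<eta>b[of x] unfolding abs_mult by (intro mult_mono) auto
  qed (auto simp: \<eta>z)
  obtain K where K: "\<And>x. x \<in> ?E \<Longrightarrow> \<bar>w \<bullet> x + d\<bar> \<le> K"
  proof -
    have "compact ((\<lambda>x. w \<bullet> x + d) ` ?E)"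
      by (intro compact_continuous_image compact_cylinder \<rho> r continuous_intros)
    then obtain K where "\<forall>y\<in>(\<lambda>x. w \<bullet> x + d) ` ?E. norm y \<le> K"
      by (meson bounded_iff compact_imp_bounded)
    then show ?thesis by (intro that[of K]) auto
  qed
  have int_f: "integrable lborel (\<lambda>x. f x * \<eta> x)" using fb by (intro int) auto
  have int_fd: "integrable lborel (\<lambda>x. f (dil I s x) * \<eta> x)" for s
    using fb by (intro int) auto
  have int_l: "integrable lborel (\<lambda>x. (w \<bullet> x + d) * \<eta> x)" using K by (intro int) auto
  have int_l0: "integrable lborel (\<lambda>x. (w \<bullet> dil I 0 x + d) * \<eta> x)"
    using K dil_cylinder[of _ I \<rho> r 0] by (intro int) auto
  define L where "L = (\<integral>x. (w \<bullet> dil I 0 x + d) * \<eta> x \<partial>lborel)"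
  \<comment> \<open>The weight is even in z, so averaging an affine function over x and its
    reflection \<open>dil I (- 1) x\<close> leaves its value at the projection
    \<open>dil I 0 x\<close>.\<close>
  have L: "L = (\<integral>x. (w \<bullet> x + d) * \<eta> x \<partial>lborel)"
  proof -
    have e: "\<eta> (dil I (- 1) x) = \<eta> x" for x by (simp add: \<eta>_def \<theta>_def cylfun_dil_compl)
    have r: "x + dil I (- 1) x = 2 *\<^sub>R dil I 0 x" for x by (simp add: vec_eq_iff dil_nth)
    have r2: "w \<bullet> x + w \<bullet> dil I (-1) x = 2 * (w \<bullet> dil I 0 x)" for x
      using arg_cong[OF r, of "\<lambda>v. w \<bullet> v"] by (simp add: inner_add_right)
    have "(\<integral>x. (w \<bullet> x + d) * \<eta> x \<partial>lborel) = (\<integral>x. (w \<bullet> dil I (-1) x + d) * \<eta> x \<partial>lborel)"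
      using integral_dil[of "\<lambda>x. (w \<bullet> x + d) * \<eta> x" "-1" I] by (simp add: e)
    moreover have "integrable lborel (\<lambda>x. (w \<bullet> dil I (-1) x + d) * \<eta> x)"
    proof (rule int[of _ K])
      show "\<bar>w \<bullet> dil I (-1) x + d\<bar> \<le> K" if "x \<in> ?E" for x
        using that by (intro K) (simp add: cylinder_def cylfun_dil_compl)
    qed auto
    ultimately have "2 * (\<integral>x. (w \<bullet> x + d) * \<eta> x \<partial>lborel)
        = (\<integral>x. (w \<bullet> x + d) * \<eta> x + (w \<bullet> dil I (-1) x + d) * \<eta> x \<partial>lborel)"
      using int_l by simp
    also have "\<dots> = (\<integral>x. 2 * ((w \<bullet> dil I 0 x + d) * \<eta> x) \<partial>lborel)"
    proof (intro Bochner_Integration.integral_cong refl)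
      fix x
      have "(w \<bullet> x + d) * \<eta> x + (w \<bullet> dil I (-1) x + d) * \<eta> x = (w \<bullet> x + w \<bullet> dil I (-1) x + 2 * d) * \<eta> x"
        by (simp add: algebra_simps)
      then show "(w \<bullet> x + d) * \<eta> x + (w \<bullet> dil I (-1) x + d) * \<eta> x = 2 * ((w \<bullet> dil I 0 x + d) * \<eta> x)"
        by (simp add: r2 algebra_simps)
    qed
    finally show ?thesis by (simp add: L_def)
  qed
  \<comment> \<open>Here \<sigma> = 1/s. Of the \<open>Suc N\<close> factors, \<open>N\<close> are
    the Jacobian and the last one clears the factor s in front of f.\<close>
  have step: "\<sigma> ^ Suc N * (\<integral>x. f x * \<eta> (dil I \<sigma> x) \<partial>lborel) \<le> (\<integral>x. f x * \<eta> x \<partial>lborel) + (\<sigma> - 1) * L"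
    if \<sigma>: "\<sigma> > 1" for \<sigma>
  proof -
    define s where "s = 1 / \<sigma>"
    have s: "0 < s" "s < 1" "\<sigma> * s = 1" using \<sigma> by (auto simp: s_def)
    have inv: "dil I s (dil I \<sigma> x) = x" for x using \<sigma> by (simp add: vec_eq_iff dil_nth s_def)
    have "\<sigma> ^ N * (\<integral>x. f x * \<eta> (dil I \<sigma> x) \<partial>lborel) = (\<integral>x. f (dil I s x) * \<eta> x \<partial>lborel)"
      using integral_dil[of "\<lambda>x. f (dil I s x) * \<eta> x" \<sigma> I] \<sigma> by (simp add: inv N_def)
    also have "\<dots> \<le> (\<integral>x. s * (f x * \<eta> x) + (1 - s) * ((w \<bullet> dil I 0 x + d) * \<eta> x) \<partial>lborel)"
    proof (rule integral_mono)
      fix x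
      show "f (dil I s x) * \<eta> x \<le> s * (f x * \<eta> x) + (1 - s) * ((w \<bullet> dil I 0 x + d) * \<eta> x)"
      proof (cases "x \<in> ?E")
        case True
        then show ?thesis using mult_right_mono[OF fc[OF True s(1,2)] \<eta>0[of x]] by (simp add: algebra_simps)
      qed (simp add: \<eta>z)
    qed (use int_f int_fd int_l0 in auto)
    also have "\<dots> = s * (\<integral>x. f x * \<eta> x \<partial>lborel) + (1 - s) * L"
      using int_f int_l0 by (simp add: L_def)
    finally have "\<sigma> * (\<sigma> ^ N * (\<integral>x. f x * \<eta> (dil I \<sigma> x) \<partial>lborel))
        \<le> \<sigma> * (s * (\<integral>x. f x * \<eta> x \<partial>lborel) + (1 - s) * L)"
      using \<sigma> by (intro mult_left_mono) auto
    also have "\<dots> = (\<sigma> * s) * (\<integral>x. f x * \<eta> x \<partial>lborel) + (\<sigma> - \<sigma> * s) * L"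
      by (simp add: algebra_simps)
    finally show ?thesis using s by simp
  qed
  \<comment> \<open>A sequence decreasing to 1 inside the interval where
    \<open>scale_prof_lipschitz\<close> applies; it stays above 1 because the hypothesis on f is
    about s < 1.\<close>
  define \<sigma> where "\<sigma> j = 1 + 1 / real (Suc j)" for j
  have \<sigma>: "1 < \<sigma> j" "\<sigma> j \<le> 2" for j by (auto simp: \<sigma>_def field_simps)
  have \<sigma>lim: "filterlim \<sigma> (at 1) sequentially"
  proof -
    have "\<sigma> \<longlonglongrightarrow> 1 + 0" unfolding \<sigma>_def[abs_def]
      by (intro tendsto_intros LIMSEQ_Suc[OF lim_1_over_n])
    then show ?thesis using \<sigma>(1) by (auto simp: filterlim_at less_le)
  qed
  \<comment> \<open>Difference quotients at \<sigma> = 1 of the dilated weight, and their limit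
    \<open>G\<close>. The factor \<theta> comes out because \<open>dil\<close> does not move the
    coordinates in \<open>I\<close>. By \<open>step\<close>, each \<open>F j\<close> has integral at
    most \<open>L\<close>.\<close>
  define F where "F j x = f x * (\<theta> x * ((scale_prof N (\<zeta> x) (\<sigma> j) - scale_prof N (\<zeta> x) 1) / (\<sigma> j - 1)))" for j x
  define G where "G x = f x * (\<theta> x * scale_prof' N (\<zeta> x) 1)" for x
  obtain C where C: "C > 0"
    "\<And>z \<sigma>. 0 \<le> z \<Longrightarrow> z \<le> 1 \<Longrightarrow> 1 < \<sigma> \<Longrightarrow> \<sigma> \<le> 2 \<Longrightarrow>
       \<bar>(scale_prof N z \<sigma> - scale_prof N z 1) / (\<sigma> - 1)\<bar> \<le> C"
    using scale_prof_lipschitz by blast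
  have lim: "(\<lambda>j. integral\<^sup>L lborel (F j)) \<longlonglongrightarrow> integral\<^sup>L lborel G"
  proof (rule integral_dominated_convergence[where w="\<lambda>x. M * C * indicator ?E x"])
    show "G \<in> borel_measurable lborel" unfolding G_def scale_prof'_def by measurable
    show "F j \<in> borel_measurable lborel" for j unfolding F_def scale_prof_def by measurable
    show "integrable lborel (\<lambda>x. M * C * indicator ?E x)"
      by (intro integrable_bounded_cylinder[OF \<rho> r, where C="\<bar>M * C\<bar>" and I=I]) auto
    show "AE x in lborel. (\<lambda>j. F j x) \<longlonglongrightarrow> G x"
    proof (intro AE_I2)
      fix x
      have "((\<lambda>\<sigma>. (scale_prof N (\<zeta> x) \<sigma> - scale_prof N (\<zeta> x) 1) / (\<sigma> - 1)) \<longlongrightarrow> scale_prof' N (\<zeta> x) 1) (at 1)"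
        using scale_prof_deriv by (simp add: has_field_derivative_iff)
      from filterlim_compose[OF this \<sigma>lim] show "(\<lambda>j. F j x) \<longlonglongrightarrow> G x"
        unfolding F_def G_def by (intro tendsto_intros)
    qed
    show "AE x in lborel. norm (F j x) \<le> M * C * indicator ?E x" for j
    proof (intro AE_I2)
      fix x
      show "norm (F j x) \<le> M * C * indicator ?E x"
      proof (cases "x \<in> ?E")
        case True
        then have "\<bar>f x\<bar> * (\<bar>\<theta> x\<bar> * \<bar>(scale_prof N (\<zeta> x) (\<sigma> j) - scale_prof N (\<zeta> x) 1) / (\<sigma> j - 1)\<bar>) \<le> M * (1 * C)"
          using C(2)[OF \<zeta>(1)[of x] \<zeta>(2)[OF True] \<sigma>] fb[of x] M0 C(1) \<theta>[of x]
          by (intro mult_mono) auto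
        then show ?thesis using True by (simp add: F_def abs_mult)
      qed (simp add: F_def fz)
    qed
  qed
  have "integral\<^sup>L lborel (F j) \<le> L" for j
  proof -
    have e: "\<theta> x * scale_prof N (\<zeta> x) (\<sigma> j) = \<sigma> j ^ Suc N * \<eta> (dil I (\<sigma> j) x)" for x
      by (simp add: \<eta>_def \<theta>_def \<zeta>_def scale_prof_def cylfun_dil_compl)
    have e1: "\<theta> x * scale_prof N (\<zeta> x) 1 = \<eta> x" for x
      by (simp add: \<eta>_def \<zeta>_def scale_prof_def)
    have F: "F j x = (1 / (\<sigma> j - 1)) * (\<sigma> j ^ Suc N * (f x * \<eta> (dil I (\<sigma> j) x)) - f x * \<eta> x)" for x
    proof -
      have "F j x = (1 / (\<sigma> j - 1)) * (f x * (\<theta> x * scale_prof N (\<zeta> x) (\<sigma> j)) - f x * (\<theta> x * scale_prof N (\<zeta> x) 1))"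
        by (simp add: F_def algebra_simps diff_divide_distrib)
      then show ?thesis unfolding e e1 by (simp add: algebra_simps)
    qed
    have "integrable lborel (\<lambda>x. f x * \<eta> (dil I (\<sigma> j) x))"
    proof (rule integrable_bounded_cylinder[OF \<rho> r, where C="M * C1" and I=I])
      show "\<bar>f x * \<eta> (dil I (\<sigma> j) x)\<bar> \<le> M * C1" for x
        unfolding abs_mult using fb[of x] \<eta>b[of "dil I (\<sigma> j) x"] M0 by (intro mult_mono) auto
    qed (auto simp: fz)
    then have "integral\<^sup>L lborel (F j) = (1 / (\<sigma> j - 1)) *
        (\<sigma> j ^ Suc N * (\<integral>x. f x * \<eta> (dil I (\<sigma> j) x) \<partial>lborel) - (\<integral>x. f x * \<eta> x \<partial>lborel))"
      unfolding F[abs_def] using int_f by simp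
    also have "\<dots> \<le> (1 / (\<sigma> j - 1)) * ((\<sigma> j - 1) * L)"
      using step[OF \<sigma>(1)[of j]] \<sigma>(1)[of j] by (intro mult_left_mono) auto
    finally show ?thesis using \<sigma>(1)[of j] by simp
  qed
  then have le: "integral\<^sup>L lborel G \<le> L"
    by (intro LIMSEQ_le_const2[OF lim]) auto
  let ?R = "\<lambda>x. f x * (bump 0 (cylfun I \<rho> x) * (2 * (1 - cylfun (-I) r x) * bump 2 (cylfun (-I) r x)
           - real N * bump 1 (cylfun (-I) r x)))"
  \<comment> \<open>At \<sigma> = 1 the derivative is (N + 1) \<open>bump 1\<close> - 2 \<zeta>
    \<open>bump 2\<close>; subtracted from the single \<open>bump 1\<close> in \<eta>, it leaves the
    weight of the conclusion.\<close>
  have GR: "?R x = f x * \<eta> x - G x" for x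
    by (simp add: G_def \<eta>_def \<theta>_def \<zeta>_def scale_prof'_def algebra_simps)
  have "integrable lborel G"
  proof (rule integrable_bounded_cylinder[OF \<rho> r])
    show "G \<in> borel_measurable borel" unfolding G_def scale_prof'_def by measurable
    show "\<bar>G x\<bar> \<le> M * (1 * C)" if x: "x \<in> ?E" for x
    proof (rule LIMSEQ_le_const2)
      have "((\<lambda>\<sigma>. (scale_prof N (\<zeta> x) \<sigma> - scale_prof N (\<zeta> x) 1) / (\<sigma> - 1)) \<longlongrightarrow> scale_prof' N (\<zeta> x) 1) (at 1)"
        using scale_prof_deriv by (simp add: has_field_derivative_iff)
      from filterlim_compose[OF this \<sigma>lim] show "(\<lambda>j. \<bar>F j x\<bar>) \<longlonglongrightarrow> \<bar>G x\<bar>"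
        unfolding F_def G_def by (intro tendsto_intros)
      have "\<bar>f x\<bar> * (\<bar>\<theta> x\<bar> * \<bar>(scale_prof N (\<zeta> x) (\<sigma> j) - scale_prof N (\<zeta> x) 1) / (\<sigma> j - 1)\<bar>) \<le> M * (1 * C)" for j
          using C(2)[OF \<zeta>(1)[of x] \<zeta>(2)[OF x] \<sigma>] fb[of x] M0 C(1) \<theta>[of x]
          by (intro mult_mono) auto
      then show "\<exists>N. \<forall>n\<ge>N. \<bar>F n x\<bar> \<le> M * (1 * C)" by (simp add: F_def abs_mult)
    qed
  qed (simp add: G_def fz)
  then have "(\<integral>x. ?R x \<partial>lborel) = (\<integral>x. f x * \<eta> x \<partial>lborel) - integral\<^sup>L lborel G"
    unfolding GR[abs_def] using int_f by simp
  moreover have "(\<integral>x. (f x - (w \<bullet> x + d)) * \<eta> x \<partial>lborel) = (\<integral>x. f x * \<eta> x \<partial>lborel) - L"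
    unfolding L left_diff_distrib using int_f int_l by simp
  ultimately show ?thesis using le by (simp add: \<eta>_def \<theta>_def)
qed

section \<open>Lower bound from the Monge-Ampere inequality\<close>

lemma content_cbox_cart_le:
  fixes a b :: "real^'n"
  assumes "\<And>i. a $ i \<le> b $ i"
  shows "measure lborel (cbox a b) = (\<Prod>i\<in>UNIV. b $ i - a $ i)"
  by (rule content_cbox_cart) (use assms in \<open>auto simp: interval_ne_empty_cart\<close>)

lemma emeasure_cbox_cart_le:
  fixes a b :: "real^'n"
  assumes "\<And>i. a $ i \<le> b $ i"
  shows "emeasure lborel (cbox a b) = ennreal (\<Prod>i\<in>UNIV. b $ i - a $ i)"
  using content_cbox_cart_le[OF assms] by (metis emeasure_eq_ennreal_measure emeasure_lborel_cbox_finite infinity_ennreal_def less_irrefl)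

lemma emeasure_isometry_image:
  fixes Q :: "'a::euclidean_space \<Rightarrow> 'a"
  assumes Q: "orthogonal_transformation Q" and S: "compact S"
  shows "emeasure lborel ((\<lambda>x. c + Q x) ` S) = emeasure lborel S"
proof -
  let ?A = "\<lambda>x. c + Q x"
  have cA: "continuous_on X ?A" for X
    by (intro continuous_intros continuous_on_orthogonal_transformation Q)
  have inj: "inj ?A" using orthogonal_transformation_inj[OF Q] by (auto simp: inj_on_def)
  have "compact (?A ` S)" by (intro compact_continuous_image cA S)
  then have [measurable]: "?A ` S \<in> sets borel" by (rule borel_compact)
  have [measurable]: "?A \<in> borel_measurable borel" by (intro borel_measurable_continuous_onI cA)
  have "emeasure lborel (?A ` S) = emeasure (distr lborel borel ?A) (?A ` S)"
    by (simp add: lborel_distr_isometry[OF Q])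
  also have "\<dots> = emeasure lborel (?A -` (?A ` S))" by (simp add: emeasure_distr)
  also have "?A -` (?A ` S) = S" using inj by (rule inj_vimage_image_eq)
  finally show ?thesis .
qed

text \<open>Integrate \<open>p \<bullet> (y - x) \<le> v y\<close> over the sub-box of the orthant in which all terms of \<open>p \<bullet> (y - x)\<close> are
  nonnegative and the \<open>i\<close>-th one is large.\<close>

lemma subgradient_component_bound:
  fixes v :: "real^'n \<Rightarrow> real" and \<tau> p x :: "real^'n"
  defines "T \<equiv> (\<Prod>i\<in>UNIV. \<tau> $ i)"
  assumes \<tau>: "\<And>i. \<tau> $ i > 0"
    and cv: "continuous_on (cbox (- \<tau>) \<tau>) v"
    and v0: "\<And>y. y \<in> cbox (- \<tau>) \<tau> \<Longrightarrow> v y \<ge> 0"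
    and x: "\<And>i. \<bar>x $ i\<bar> \<le> \<tau> $ i / 2"
    and sub: "\<And>y. y \<in> cbox (- \<tau>) \<tau> \<Longrightarrow> p \<bullet> (y - x) \<le> v y"
  shows "\<bar>p $ i\<bar> * (\<tau> $ i * T) \<le> 2 ^ (CARD('n) + 3) * (\<integral>y. indicator (cbox (- \<tau>) \<tau>) y * v y \<partial>lborel)"
proof -
  \<comment> \<open>The box \<open>cbox l m\<close> lies on the side of x where each
    \<open>p $ j\<close> pushes upward: the i-th coordinate moves by between 1/4 and 1/2 of
    \<open>\<tau> $ i\<close>, every other one by at most half of \<open>\<tau> $ j\<close>. The
    height \<bar>p $ i\<bar> \<open>\<tau> $ i\<close> / 4 and the volume
    \<open>T / 2 ^ (CARD('n) + 1)\<close> together produce the power CARD('n) + 3.\<close>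
  define \<omega> where "\<omega> j = (if j = i then \<tau> $ j / 4 else 0)" for j
  define l m :: "real^'n" where "l = (\<chi> j. x $ j + (if p $ j \<ge> 0 then \<omega> j else - (\<tau> $ j / 2)))"
    and "m = (\<chi> j. x $ j + (if p $ j \<ge> 0 then \<tau> $ j / 2 else - \<omega> j))"
  have \<omega>: "0 \<le> \<omega> j" "\<omega> j \<le> \<tau> $ j / 2" for j using \<tau>[of j] by (auto simp: \<omega>_def)
  have sS: "cbox l m \<subseteq> cbox (- \<tau>) \<tau>"
  proof
    fix y assume y: "y \<in> cbox l m"
    show "y \<in> cbox (- \<tau>) \<tau>"
      unfolding mem_box_cart
    proof
      fix j
      show "(- \<tau>) $ j \<le> y $ j \<and> y $ j \<le> \<tau> $ j"
        using y[unfolded mem_box_cart, rule_format, of j] x[of j] \<omega>[of j] \<tau>[of j]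
        by (auto simp: l_def m_def split: if_splits)
    qed
  qed
  have lower: "\<bar>p $ i\<bar> * (\<tau> $ i / 4) \<le> v y" if y: "y \<in> cbox l m" for y
  proof -
    have nn: "p $ j * (y $ j - x $ j) \<ge> \<bar>p $ j\<bar> * \<omega> j" for j
    proof (cases "p $ j \<ge> 0")
      case True
      then show ?thesis using y[unfolded mem_box_cart, rule_format, of j]
        by (auto simp: l_def m_def intro!: mult_left_mono)
    next
      case False
      then have "(- p $ j) * \<omega> j \<le> (- p $ j) * (x $ j - y $ j)"
        using y[unfolded mem_box_cart, rule_format, of j]
        by (intro mult_left_mono) (auto simp: l_def m_def)
      then show ?thesis using False by (simp add: algebra_simps)
    qed
    have "\<bar>p $ i\<bar> * (\<tau> $ i / 4) = \<bar>p $ i\<bar> * \<omega> i" by (simp add: \<omega>_def)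
    also have "\<dots> \<le> (\<Sum>j\<in>UNIV. \<bar>p $ j\<bar> * \<omega> j)"
      using \<omega> by (intro member_le_sum) auto
    also have "\<dots> \<le> p \<bullet> (y - x)" unfolding inner_vec_def by (intro sum_mono) (use nn in auto)
    also have "\<dots> \<le> v y" using sub sS y by blast
    finally show ?thesis .
  qed
  have vol: "measure lborel (cbox l m) = T / 2 ^ (CARD('n) + 1)"
  proof -
    have "measure lborel (cbox l m) = (\<Prod>j\<in>UNIV. m $ j - l $ j)"
      by (rule content_cbox_cart_le) (use \<omega> in \<open>auto simp: l_def m_def\<close>)
    also have "\<dots> = (\<Prod>j\<in>UNIV. (\<tau> $ j / 2) * (if j = i then 1 / 2 else 1))"
      by (intro prod.cong) (auto simp: l_def m_def \<omega>_def)
    also have "\<dots> = T / 2 ^ (CARD('n) + 1)"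
      by (simp add: prod.distrib prod_dividef T_def)
    finally show ?thesis .
  qed
  have int: "integrable lborel (\<lambda>y. indicator (cbox (- \<tau>) \<tau>) y * v y)"
    using borel_integrable_compact[OF compact_cbox cv] by simp
  have "\<bar>p $ i\<bar> * (\<tau> $ i / 4) * (T / 2 ^ (CARD('n) + 1))
      = (\<integral>y. \<bar>p $ i\<bar> * (\<tau> $ i / 4) * indicator (cbox l m) y \<partial>lborel)"
    using vol by simp
  also have "\<dots> \<le> (\<integral>y. indicator (cbox (- \<tau>) \<tau>) y * v y \<partial>lborel)"
  proof (rule integral_mono[OF _ int])
    show "integrable lborel (\<lambda>y. \<bar>p $ i\<bar> * (\<tau> $ i / 4) * indicator (cbox l m) y)"
      by (intro integrable_mult_right integrable_real_indicator)
        (use emeasure_lborel_cbox_finite[of l m] in auto)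
    show "\<bar>p $ i\<bar> * (\<tau> $ i / 4) * indicator (cbox l m) y \<le> indicator (cbox (- \<tau>) \<tau>) y * v y" for y
      using lower[of y] v0[of y] sS by (auto simp: indicator_def)
  qed
  finally show ?thesis by (simp add: field_simps power_add)
qed

text \<open>The subgradients over the half-size box lie in a box with half-sides
  \<open>\<beta> $ i\<close> proportional to J / (\<open>\<tau> $ i\<close> T). Comparing volumes
  gives T \<le> (C J)^n / (T T^n), where one factor T is the product of the
  \<open>\<tau> $ i\<close>; this is the exponent n + 2. Each direction uses its own width, so long
  thin boxes lose only a dimensional constant.\<close>

lemma MA_lower_bound:
  fixes u :: "real^'n \<Rightarrow> real" and \<tau> c a :: "real^'n" and Q :: "real^'n \<Rightarrow> real^'n" and b :: real
  defines "T \<equiv> (\<Prod>i\<in>UNIV. \<tau> $ i)"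
  defines "v \<equiv> \<lambda>x. u (c + Q x) - (a \<bullet> (c + Q x) + b)"
  defines "J \<equiv> (\<integral>y. indicator (cbox (- \<tau>) \<tau>) y * v y \<partial>lborel)"
  assumes Q: "orthogonal_transformation Q"
    and MA: "MA_ge_one U u"
    and \<tau>: "\<And>i. \<tau> $ i > 0"
    and box: "(\<lambda>x. c + Q x) ` cbox (- \<tau>) \<tau> \<subseteq> U"
    and cu: "continuous_on U u"
    and supp: "\<And>x. x \<in> U \<Longrightarrow> a \<bullet> x + b \<le> u x"
  shows "T ^ (CARD('n) + 2) \<le> (2 ^ (CARD('n) + 4) * J) ^ CARD('n)"
proof -
  let ?A = "\<lambda>x. c + Q x"
  let ?n = "CARD('n)"
  have cA: "continuous_on X ?A" for X
    by (intro continuous_intros continuous_on_orthogonal_transformation Q)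
  interpret Q: linear Q using Q by (rule orthogonal_transformation_linear)
  have Qi: "Q x \<bullet> Q y = x \<bullet> y" for x y using Q by (simp add: orthogonal_transformation_def)
  have T: "T > 0" unfolding T_def using \<tau> by (intro prod_pos) auto
  have cv: "continuous_on (cbox (- \<tau>) \<tau>) v"
    unfolding v_def using box
    by (intro continuous_intros cA continuous_on_compose2[OF cu] continuous_on_orthogonal_transformation Q) auto
  have v0: "v y \<ge> 0" if "y \<in> cbox (- \<tau>) \<tau>" for y
    using supp[of "?A y"] box that by (auto simp: v_def)
  have J: "J \<ge> 0" unfolding J_def
    by (intro Bochner_Integration.integral_nonneg) (auto simp: indicator_def v0)
  define \<beta> :: "real^'n" where "\<beta> = (\<chi> i. 2 ^ (?n + 3) * J / (\<tau> $ i * T))"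
  have \<beta>: "\<beta> $ i \<ge> 0" for i using J T \<tau>[of i] by (simp add: \<beta>_def)
  \<comment> \<open>Halving leaves room for the displaced boxes of
    \<open>subgradient_component_bound\<close>, and makes the volume of \<open>H\<close> exactly
    \<open>T\<close>.\<close>
  define H where "H = cbox (- ((1/2) *\<^sub>R \<tau>)) ((1/2) *\<^sub>R \<tau>)"
  have HB: "H \<subseteq> cbox (- \<tau>) \<tau>"
  proof
    fix x assume x: "x \<in> H"
    have "(- \<tau>) $ j \<le> x $ j \<and> x $ j \<le> \<tau> $ j" for j
      using x[unfolded H_def mem_box_cart, rule_format, of j] \<tau>[of j] by auto
    then show "x \<in> cbox (- \<tau>) \<tau>" by (simp add: mem_box_cart)
  qed
  have incl: "(\<Union>x\<in>?A ` H. subdiff U u x) \<subseteq> (\<lambda>x. a + Q x) ` cbox (- \<beta>) \<beta>"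
  proof
    fix q assume "q \<in> (\<Union>x\<in>?A ` H. subdiff U u x)"
    then obtain x where x: "x \<in> H" and q: "q \<in> subdiff U u (?A x)" by auto
    \<comment> \<open>Removing the affine function shifts subgradients by \<open>a\<close>, and
      \<open>Q\<close> preserves inner products; thus \<open>p\<close> is a subgradient of
      \<open>v\<close> relative to the box.\<close>
    obtain p where p: "q - a = Q p" using orthogonal_transformation_surj[OF Q] by (metis surjD)
    have "\<bar>p $ i\<bar> * (\<tau> $ i * T) \<le> 2 ^ (?n + 3) * J" for i
      unfolding T_def J_def
    proof (rule subgradient_component_bound[OF \<tau> cv v0])
      show "\<bar>x $ i\<bar> \<le> \<tau> $ i / 2" for i
        using x[unfolded H_def mem_box_cart, rule_format, of i] by (auto simp: abs_le_iff)
      show "p \<bullet> (y - x) \<le> v y" if y: "y \<in> cbox (- \<tau>) \<tau>" for y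
      proof -
        have "u (?A x) + q \<bullet> (?A y - ?A x) \<le> u (?A y)"
        proof -
          have "?A y \<in> U" using y box by blast
          with q show ?thesis unfolding subdiff_def by blast
        qed
        moreover have "a \<bullet> ?A x + b \<le> u (?A x)" using supp HB x box by blast
        moreover have "q \<bullet> (?A y - ?A x) = a \<bullet> ?A y - a \<bullet> ?A x + p \<bullet> (y - x)"
        proof -
          have "q \<bullet> (?A y - ?A x) = a \<bullet> (?A y - ?A x) + (q - a) \<bullet> (?A y - ?A x)"
            by (simp add: inner_diff_left)
          also have "(q - a) \<bullet> (?A y - ?A x) = Q p \<bullet> Q (y - x)" unfolding p by (simp add: Q.diff)
          finally show ?thesis by (simp add: Qi inner_diff_right inner_add_right)
        qed
        ultimately show ?thesis by (simp add: v_def)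
      qed
    qed auto
    then have "\<bar>p $ i\<bar> \<le> \<beta> $ i" for i
      using T \<tau>[of i] by (simp add: \<beta>_def pos_le_divide_eq)
    then have "p \<in> cbox (- \<beta>) \<beta>" by (simp add: mem_box_cart abs_le_iff minus_le_iff)
    moreover have "q = a + Q p" using p by (simp add: algebra_simps)
    ultimately show "q \<in> (\<lambda>x. a + Q x) ` cbox (- \<beta>) \<beta>" by blast
  qed
  have comp: "compact (?A ` H)" unfolding H_def by (intro compact_continuous_image cA compact_cbox)
  have comp2: "compact ((\<lambda>x. a + Q x) ` cbox (- \<beta>) \<beta>)"
    by (intro compact_continuous_image compact_cbox continuous_intros continuous_on_orthogonal_transformation Q)
  have leb: "emeasure lebesgue X = emeasure lborel X" if "compact X" for X :: "(real^'n) set"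
    using borel_compact[OF that] by (simp add: main_part_sets)
  have "ennreal T = emeasure lborel H"
    unfolding H_def using \<tau> by (subst emeasure_cbox_cart_le) (auto simp: T_def less_imp_le)
  also have "\<dots> = emeasure lborel (?A ` H)"
    by (rule emeasure_isometry_image[OF Q, symmetric]) (simp add: H_def compact_cbox)
  also have "\<dots> = emeasure lebesgue (?A ` H)"
    by (rule leb[OF comp, symmetric])
  also have "\<dots> \<le> emeasure lebesgue (\<Union>x\<in>?A ` H. subdiff U u x)"
    using MA comp HB box unfolding MA_ge_one_def by blast
  also have "\<dots> \<le> emeasure lebesgue ((\<lambda>x. a + Q x) ` cbox (- \<beta>) \<beta>)"
    by (rule emeasure_mono[OF incl]) (use lmeasurable_compact[OF comp2] in \<open>simp add: fmeasurableD\<close>)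
  also have "\<dots> = emeasure lborel ((\<lambda>x. a + Q x) ` cbox (- \<beta>) \<beta>)"
    by (rule leb[OF comp2])
  also have "\<dots> = emeasure lborel (cbox (- \<beta>) \<beta>)"
    by (rule emeasure_isometry_image[OF Q compact_cbox])
  also have "\<dots> = ennreal (\<Prod>i\<in>UNIV. 2 * \<beta> $ i)"
  proof (subst emeasure_cbox_cart_le)
    show "(- \<beta>) $ i \<le> \<beta> $ i" for i using \<beta>[of i] by simp
  qed simp
  finally have "T \<le> (\<Prod>i\<in>UNIV. 2 * \<beta> $ i)"
    using \<beta> by (subst (asm) ennreal_le_iff) (auto intro!: prod_nonneg)
  also have "\<dots> = (\<Prod>i\<in>UNIV. (2 ^ (?n + 4) * J) / (\<tau> $ i * T))"
    by (intro prod.cong) (auto simp: \<beta>_def power_add)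
  also have "\<dots> = (2 ^ (?n + 4) * J) ^ ?n / (T * T ^ ?n)"
    by (simp add: prod_dividef prod.distrib T_def)
  finally have "T * (T * T ^ ?n) \<le> (2 ^ (?n + 4) * J) ^ ?n"
    using T by (simp add: pos_le_divide_eq)
  then show ?thesis by (simp add: power_add power2_eq_square algebra_simps)
qed

section \<open>Weak second derivatives along an orthonormal frame\<close>

lemma frechet_derivative_direction:
  fixes f :: "real^'n \<Rightarrow> real"
  assumes "f differentiable (at x)" and "((\<lambda>t. f (x + t *\<^sub>R v)) has_real_derivative d) (at 0)"
  shows "frechet_derivative f (at x) v = d"
proof -
  have "(f has_derivative frechet_derivative f (at x)) (at (x + 0 *\<^sub>R v))"
    using assms(1) frechet_derivative_works by auto
  then have "((\<lambda>t. f (x + t *\<^sub>R v)) has_derivative (\<lambda>t. frechet_derivative f (at x) (t *\<^sub>R v))) (at 0)"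
    by (rule has_derivative_compose[rotated]) (auto intro!: derivative_eq_intros)
  then have "(\<lambda>t. frechet_derivative f (at x) (t *\<^sub>R v)) = (\<lambda>t. d * t)"
    using assms(2) unfolding has_field_derivative_def by (rule has_derivative_unique)
  from fun_cong[OF this, of 1] show ?thesis by simp
qed

lemma test_fun_partial:
  assumes "test_fun U \<phi>"
  shows "test_fun U (partial_deriv i \<phi>)"
proof -
  let ?S = "closure {x. \<phi> x \<noteq> 0}"
  have sub: "{x. partial_deriv i \<phi> x \<noteq> 0} \<subseteq> ?S"
  proof
    fix x assume x: "x \<in> {x. partial_deriv i \<phi> x \<noteq> 0}"
    show "x \<in> ?S"
    proof (rule ccontr)
      assume "x \<notin> ?S"
      have "(\<phi> has_derivative (\<lambda>_. 0)) (at x)"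
      proof (rule has_derivative_transform_within_open[where s="- ?S" and f="\<lambda>_. 0"])
        show "0 = \<phi> y" if "y \<in> - ?S" for y
          using that closure_subset[of "{x. \<phi> x \<noteq> 0}"] by auto
      qed (use \<open>x \<notin> ?S\<close> in auto)
      then have "partial_deriv i \<phi> x = 0" by (simp add: partial_deriv_eqI)
      with x show False by simp
    qed
  qed
  then have "closure {x. partial_deriv i \<phi> x \<noteq> 0} \<subseteq> ?S" by (rule closure_minimal) simp
  moreover from this have "compact (closure {x. partial_deriv i \<phi> x \<noteq> 0})"
    using assms unfolding test_fun_def by (meson bounded_subset compact_eq_bounded_closed closed_closure)
  moreover have "smooth_fun (partial_deriv i \<phi>)"
    using assms unfolding test_fun_def smooth_fun_def by (metis Ck.simps(2))
  ultimately show ?thesis using assms unfolding test_fun_def by blast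
qed

lemma smooth_fun_differentiable: "smooth_fun f \<Longrightarrow> f differentiable (at x)"
  unfolding smooth_fun_def by (metis Ck.simps(2))

lemma weak_second_partial:
  assumes "weak_partial U i f g" "weak_partial U j g h" and t: "test_fun U \<phi>"
  shows "integrable (lebesgue_on U) (\<lambda>x. f x * partial_deriv i (partial_deriv j \<phi>) x)"
    and "integrable (lebesgue_on U) (\<lambda>x. h x * \<phi> x)"
    and "(LINT x|lebesgue_on U. f x * partial_deriv i (partial_deriv j \<phi>) x)
       = (LINT x|lebesgue_on U. h x * \<phi> x)"
  using assms(1)[unfolded weak_partial_def, rule_format, OF test_fun_partial[OF t, of j]]
    assms(2)[unfolded weak_partial_def, rule_format, OF t]
  by simp_all

text \<open>The directional derivatives enter as given functions \<open>D1\<close> and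
  \<open>D2\<close>, so for a concrete test function they can be computed along lines in the rotated
  frame; the partial derivatives in the standard frame appear only through bilinear
  expansion.\<close>

lemma weak_second_directional:
  fixes f :: "real^'n \<Rightarrow> real" and v :: "real^'n"
  assumes w: "\<And>i. weak_partial U i f (g i)" "\<And>i j. weak_partial U j (g i) (h i j)"
    and t: "test_fun U \<phi>"
    and D1: "\<And>x. frechet_derivative \<phi> (at x) v = D1 x"
    and D2: "\<And>x. frechet_derivative D1 (at x) v = D2 x"
  shows "integrable (lebesgue_on U) (\<lambda>x. f x * D2 x)"
    and "(LINT x|lebesgue_on U. f x * D2 x)
      = (\<Sum>i\<in>UNIV. \<Sum>j\<in>UNIV. v $ i * v $ j * (LINT x|lebesgue_on U. h i j x * \<phi> x))"
proof -
  have s: "smooth_fun \<phi>" and sp: "smooth_fun (partial_deriv j \<phi>)" for j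
    using t test_fun_partial[OF t] by (auto simp: test_fun_def)
  have D1': "D1 = (\<lambda>x. \<Sum>j\<in>UNIV. v $ j * partial_deriv j \<phi> x)"
    using D1 frechet_derivative_sum_partial[OF smooth_fun_differentiable[OF s]] by fastforce
  have hd: "(D1 has_derivative (\<lambda>k. \<Sum>j\<in>UNIV. v $ j * frechet_derivative (partial_deriv j \<phi>) (at x) k)) (at x)" for x
    unfolding D1'
    by (intro has_derivative_sum has_derivative_mult_right)
       (use smooth_fun_differentiable[OF sp] frechet_derivative_works in blast)
  have D2': "D2 x = (\<Sum>i\<in>UNIV. \<Sum>j\<in>UNIV. v $ i * v $ j * partial_deriv i (partial_deriv j \<phi>) x)" for x
  proof -
    have "D2 x = (\<Sum>j\<in>UNIV. v $ j * frechet_derivative (partial_deriv j \<phi>) (at x) v)"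
      using fun_cong[OF frechet_derivative_at[OF hd[of x]], of v] D2[of x] by simp
    also have "\<dots> = (\<Sum>j\<in>UNIV. \<Sum>i\<in>UNIV. v $ i * v $ j * partial_deriv i (partial_deriv j \<phi>) x)"
      by (intro sum.cong refl) (simp add: frechet_derivative_sum_partial[OF smooth_fun_differentiable[OF sp]]
          sum_distrib_left mult_ac)
    also have "\<dots> = (\<Sum>i\<in>UNIV. \<Sum>j\<in>UNIV. v $ i * v $ j * partial_deriv i (partial_deriv j \<phi>) x)"
      by (rule sum.swap)
    finally show ?thesis .
  qed
  have e: "f x * D2 x = (\<Sum>i\<in>UNIV. \<Sum>j\<in>UNIV. v $ i * v $ j * (f x * partial_deriv i (partial_deriv j \<phi>) x))" for x
    by (simp add: D2' sum_distrib_left mult_ac)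
  note wk = weak_second_partial[OF w t]
  show "integrable (lebesgue_on U) (\<lambda>x. f x * D2 x)"
    unfolding e using wk(1) by (intro Bochner_Integration.integrable_sum integrable_mult_right)
  show "(LINT x|lebesgue_on U. f x * D2 x)
      = (\<Sum>i\<in>UNIV. \<Sum>j\<in>UNIV. v $ i * v $ j * (LINT x|lebesgue_on U. h i j x * \<phi> x))"
    unfolding e using wk(1)
    by (simp add: Bochner_Integration.integral_sum Bochner_Integration.integrable_sum wk(3)[symmetric])
qed

section \<open>Isometric coordinates and the cylindrical test function\<close>

lemma orthogonal_transformation_axis_inverse:
  fixes Q :: "real^'n \<Rightarrow> real^'n"
  assumes Q: "orthogonal_transformation Q"
  shows "(\<chi> i. Q (axis i 1) \<bullet> Q y) = y" "Q (\<chi> i. Q (axis i 1) \<bullet> x) = x"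
proof -
  show 1: "(\<chi> i. Q (axis i 1) \<bullet> Q y) = y" for y
    using Q by (simp add: orthogonal_transformation_def vec_eq_iff inner_axis')
  obtain y where "x = Q y" using orthogonal_transformation_surj[OF Q] by (metis surjD)
  then show "Q (\<chi> i. Q (axis i 1) \<bullet> x) = x" using 1 by simp
qed

text \<open>The inverse of \<open>y \<mapsto> c + Q y\<close>, written through inner products so
  that each coordinate is visibly affine in x and the \<open>Ck\<close> rules apply.\<close>

definition coords :: "(real^'n \<Rightarrow> real^'n) \<Rightarrow> real^'n \<Rightarrow> real^'n \<Rightarrow> real^'n" where
  "coords Q c x = (\<chi> i. Q (axis i 1) \<bullet> (x - c))"

lemma coords_isometry:
  assumes Q: "orthogonal_transformation Q"
  shows "coords Q c (c + Q y) = y" "c + Q (coords Q c x) = x"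
  using orthogonal_transformation_axis_inverse[OF Q] by (simp_all add: coords_def)

lemma coords_add_axis:
  assumes Q: "orthogonal_transformation Q"
  shows "coords Q c (x + t *\<^sub>R Q (axis j 1)) = coords Q c x + t *\<^sub>R axis j 1"
  using Q by (simp add: coords_def vec_eq_iff inner_add_right inner_diff_right orthogonal_transformation_def
      inner_axis' algebra_simps)

lemma cylfun_add_axis:
  "cylfun J r (y + t *\<^sub>R axis j 1) = cylfun J r y - (if j \<in> J then (2 * t * y $ j + t\<^sup>2) / r\<^sup>2 else 0)"
proof -
  have "((y + t *\<^sub>R axis j 1) $ i)\<^sup>2 = (y $ i)\<^sup>2 + (if i = j then 2 * t * y $ j + t\<^sup>2 else 0)" for i
    by (auto simp: axis_def power2_eq_square algebra_simps)
  then have "(\<Sum>i\<in>J. ((y + t *\<^sub>R axis j 1) $ i)\<^sup>2) = (\<Sum>i\<in>J. (y $ i)\<^sup>2) + (if j \<in> J then 2 * t * y $ j + t\<^sup>2 else 0)"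
    by (simp add: sum.distrib sum.delta)
  then show ?thesis by (simp add: cylfun_def add_divide_distrib)
qed

lemma Ck_cylfun_coords: "Ck k (\<lambda>x. cylfun J r (coords Q c x))"
proof -
  have "Ck k (\<lambda>x. 1 + (- (1 / r\<^sup>2)) * (\<Sum>i\<in>J. (Q (axis i 1) \<bullet> x + - (Q (axis i 1) \<bullet> c)) * (Q (axis i 1) \<bullet> x + - (Q (axis i 1) \<bullet> c))))"
    by (intro Ck_add Ck_const Ck_mult Ck_sum Ck_inner)
  then show ?thesis
    by (simp add: cylfun_def coords_def inner_diff_right power2_eq_square)
qed

lemma Ck_bump_cylfun: "Ck k (\<lambda>x. bump m (cylfun J r (coords Q c x)))"
  using Ck_compose[of bump, OF bump_derivative Ck_cylfun_coords] .

text \<open>The profile \<open>bump 0\<close> in the directions outside \<open>I\<close> is an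
  antiderivative of the profile \<open>bump 1\<close> that weights v in
  \<open>dilation_inequality\<close>; so the Laplacian in these directions reproduces the weight on
  the right there.\<close>

definition cyl_test :: "'n set \<Rightarrow> real \<Rightarrow> real \<Rightarrow> (real^'n \<Rightarrow> real^'n) \<Rightarrow> real^'n \<Rightarrow> real^'n \<Rightarrow> real" where
  "cyl_test I \<rho> r Q c x = bump 0 (cylfun I \<rho> (coords Q c x)) * bump 0 (cylfun (- I) r (coords Q c x))"

lemma cyl_test_bounds: "0 \<le> cyl_test I \<rho> r Q c x" "cyl_test I \<rho> r Q c x \<le> 1"
  using mult_mono[OF bump_0_le_1 bump_0_le_1 zero_le_one bump_0_nonneg]
  by (simp_all add: cyl_test_def bump_0_nonneg)

lemma cyl_test_zero:
  assumes "orthogonal_transformation Q" "x \<notin> (\<lambda>y. c + Q y) ` cylinder I \<rho> r"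
  shows "cyl_test I \<rho> r Q c x = 0"
proof -
  have "coords Q c x \<notin> cylinder I \<rho> r"
    using assms coords_isometry(2)[OF assms(1), of c x] by force
  then show ?thesis using bump_product_zero by (simp add: cyl_test_def)
qed

lemma test_fun_cyl_test:
  fixes Q :: "real^'n \<Rightarrow> real^'n"
  assumes Q: "orthogonal_transformation Q" and "\<rho> > 0" "r > 0"
    and "(\<lambda>y. c + Q y) ` cylinder I \<rho> r \<subseteq> U"
  shows "test_fun U (cyl_test I \<rho> r Q c)"
proof -
  let ?S = "(\<lambda>y. c + Q y) ` cylinder I \<rho> r"
  have cS: "compact ?S"
    by (intro compact_continuous_image compact_cylinder assms continuous_intros
        continuous_on_orthogonal_transformation)
  have "{x. cyl_test I \<rho> r Q c x \<noteq> 0} \<subseteq> ?S"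
    using cyl_test_zero[OF Q] by blast
  then have sub: "closure {x. cyl_test I \<rho> r Q c x \<noteq> 0} \<subseteq> ?S"
    using cS by (intro closure_minimal compact_imp_closed)
  moreover have "compact (closure {x. cyl_test I \<rho> r Q c x \<noteq> 0})"
    using sub cS by (meson bounded_subset compact_eq_bounded_closed closed_closure)
  moreover have "smooth_fun (cyl_test I \<rho> r Q c)"
    unfolding smooth_fun_def cyl_test_def[abs_def] by (intro allI Ck_mult Ck_bump_cylfun)
  ultimately show ?thesis using assms(4) unfolding test_fun_def by blast
qed

text \<open>Along a frame direction outside \<open>I\<close> the first factor is constant and the
  argument of the second is quadratic in t, so both derivatives are one-variable
  computations.\<close>

lemma cyl_test_derivatives:
  fixes Q :: "real^'n \<Rightarrow> real^'n" and I :: "'n set" and c :: "real^'n" and \<rho> r :: real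
  assumes Q: "orthogonal_transformation Q" and j: "j \<notin> I"
  defines "y \<equiv> coords Q c" and "v \<equiv> Q (axis j 1)"
  defines "D1 \<equiv> \<lambda>x. bump 0 (cylfun I \<rho> (y x)) * (bump 1 (cylfun (- I) r (y x)) * (- 2 * y x $ j / r\<^sup>2))"
  defines "D2 \<equiv> \<lambda>x. bump 0 (cylfun I \<rho> (y x)) * (bump 2 (cylfun (- I) r (y x)) * (4 * (y x $ j)\<^sup>2 / r ^ 4)
       - bump 1 (cylfun (- I) r (y x)) * (2 / r\<^sup>2))"
  shows "frechet_derivative (cyl_test I \<rho> r Q c) (at x) v = D1 x"
    and "frechet_derivative D1 (at x) v = D2 x"
proof -
  have A: "y (x + t *\<^sub>R v) = y x + t *\<^sub>R axis j 1" for t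
    unfolding y_def v_def by (rule coords_add_axis[OF Q])
  have d0: "cyl_test I \<rho> r Q c differentiable (at x)"
    by (rule smooth_fun_differentiable) (auto simp: smooth_fun_def cyl_test_def[abs_def] intro!: Ck_mult Ck_bump_cylfun)
  have C: "Ck k (\<lambda>x. bump 0 (cylfun I \<rho> (y x)) * (bump 1 (cylfun (- I) r (y x)) *
      ((- 2 / r\<^sup>2) * (Q (axis j 1) \<bullet> x + - (Q (axis j 1) \<bullet> c)))))" for k
    unfolding y_def by (intro Ck_mult Ck_bump_cylfun Ck_const Ck_add Ck_inner)
  have E: "(- 2 / r\<^sup>2) * (Q (axis j 1) \<bullet> x + - (Q (axis j 1) \<bullet> c)) = - 2 * y x $ j / r\<^sup>2" for x
    by (simp add: y_def coords_def inner_diff_right minus_divide_left[symmetric] diff_divide_distrib)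
  have "Ck k D1" for k using C[unfolded E] unfolding D1_def .
  then have d1: "D1 differentiable (at x)"
    by (intro smooth_fun_differentiable) (simp add: smooth_fun_def)
  let ?s = "cylfun (- I) r (y x)" and ?z = "y x $ j"
  have K: "((\<lambda>t. ?s - (2 * t * ?z + t\<^sup>2) / r\<^sup>2) has_real_derivative - 2 * ?z / r\<^sup>2) (at 0)"
    unfolding divide_inverse by (rule derivative_eq_intros refl)+ simp
  have B: "((\<lambda>t. bump m (?s - (2 * t * ?z + t\<^sup>2) / r\<^sup>2)) has_real_derivative
      bump (Suc m) ?s * (- 2 * ?z / r\<^sup>2)) (at 0)" for m
    using DERIV_chain2[OF bump_derivative K, of m] by simp
  have L: "((\<lambda>t. - 2 * (?z + t) / r\<^sup>2) has_real_derivative - 2 / r\<^sup>2) (at 0)"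
    unfolding divide_inverse by (rule derivative_eq_intros refl)+ simp
  show "frechet_derivative (cyl_test I \<rho> r Q c) (at x) v = D1 x"
  proof (rule frechet_derivative_direction[OF d0])
    have "((\<lambda>t. bump 0 (cylfun I \<rho> (y x)) * bump 0 (cylfun (- I) r (y x) - (2 * t * y x $ j + t\<^sup>2) / r\<^sup>2))
        has_real_derivative D1 x) (at 0)"
      using DERIV_cmult[OF B[of 0], of "bump 0 (cylfun I \<rho> (y x))"] by (simp add: D1_def)
    then show "((\<lambda>t. cyl_test I \<rho> r Q c (x + t *\<^sub>R v)) has_real_derivative D1 x) (at 0)"
      using j by (simp add: cyl_test_def A[unfolded y_def] y_def cylfun_add_axis)
  qed
  show "frechet_derivative D1 (at x) v = D2 x"
  proof (rule frechet_derivative_direction[OF d1])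
    have eq: "D1 (x + t *\<^sub>R v) = bump 0 (cylfun I \<rho> (y x)) * (bump 1 (cylfun (- I) r (y x) - (2 * t * y x $ j + t\<^sup>2) / r\<^sup>2)
        * (- 2 * (y x $ j + t) / r\<^sup>2))" for t
    proof -
      have "(y x + t *\<^sub>R axis j 1) $ j = y x $ j + t" by simp
      then show ?thesis unfolding D1_def A cylfun_add_axis
        by (simp only: j Compl_iff simp_thms if_True if_False diff_zero)
    qed
    have "((\<lambda>t. bump 0 (cylfun I \<rho> (y x)) * (bump 1 (cylfun (- I) r (y x) - (2 * t * y x $ j + t\<^sup>2) / r\<^sup>2)
        * (- 2 * (y x $ j + t) / r\<^sup>2))) has_real_derivative D2 x) (at 0)"
      using DERIV_cmult[OF DERIV_mult[OF B[of 1, unfolded Suc_1] L], of "bump 0 (cylfun I \<rho> (y x))"]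
      by (simp add: D2_def power2_eq_square power4_eq_xxxx algebra_simps)
    then show "((\<lambda>t. D1 (x + t *\<^sub>R v)) has_real_derivative D2 x) (at 0)"
      unfolding eq .
  qed
qed

text \<open>Replaces Hoelder: \<open>\<bar>g\<bar> \<le> l + l powr (1 - p) * \<bar>g\<bar> powr p\<close>, with \<open>l\<close> to be chosen at the critical scale.\<close>

lemma Lp_truncated_bound:
  fixes g \<phi> :: "real^'n \<Rightarrow> real"
  assumes Lp: "Lp p U g" and p: "p \<ge> 1" and l: "l > 0" and U: "U \<in> sets lebesgue"
    and S: "compact S" "S \<subseteq> U"
    and \<phi>: "\<And>x. \<bar>\<phi> x\<bar> \<le> indicator S x" and int: "integrable (lebesgue_on U) (\<lambda>x. g x * \<phi> x)"
  shows "\<bar>LINT x|lebesgue_on U. g x * \<phi> x\<bar>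
    \<le> l * measure lborel S + l powr (1 - p) * (LINT x|lebesgue_on U. \<bar>g x\<bar> powr p * indicator S x)"
proof -
  have Sb: "S \<in> sets borel" using S(1) by (rule borel_compact)
  then have SL: "S \<in> sets lebesgue" by simp
  have SU: "S \<in> sets (lebesgue_on U)" using SL S(2) U by (auto simp: sets_restrict_space_iff)
  have mS: "measure (lebesgue_on U) S = measure lborel S"
    using S U Sb by (simp add: measure_restrict_space)
  have fS: "emeasure (lebesgue_on U) S < \<infinity>"
    using S U SL emeasure_compact_finite[OF S(1)] Sb
    by (simp add: emeasure_restrict_space main_part_sets)
  have intp: "integrable (lebesgue_on U) (\<lambda>x. \<bar>g x\<bar> powr p * indicator S x)"
    using Lp SU by (intro integrable_real_mult_indicator) (auto simp: Lp_def)
  have intS: "integrable (lebesgue_on U) (indicator S :: _ \<Rightarrow> real)"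
    using SU fS by (rule integrable_real_indicator)
  have pt: "\<bar>g x * \<phi> x\<bar> \<le> l * indicator S x + l powr (1 - p) * (\<bar>g x\<bar> powr p * indicator S x)" for x
  proof -
    have "\<bar>g x\<bar> \<le> l + l powr (1 - p) * \<bar>g x\<bar> powr p"
    proof (cases "\<bar>g x\<bar> \<le> l")
      case True
      have "0 \<le> l powr (1 - p) * \<bar>g x\<bar> powr p" by simp
      with True show ?thesis by linarith
    next
      case False
      have "\<bar>g x\<bar> = \<bar>g x\<bar> powr (1 - p) * \<bar>g x\<bar> powr p"
        using False l by (simp add: powr_add[symmetric])
      also have "\<dots> \<le> l powr (1 - p) * \<bar>g x\<bar> powr p"
        using False l p by (intro mult_right_mono powr_mono2') auto
      finally show ?thesis using l by linarith
    qed
    then have "\<bar>g x\<bar> * \<bar>\<phi> x\<bar> \<le> (l + l powr (1 - p) * \<bar>g x\<bar> powr p) * indicator S x"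
      using \<phi>[of x] by (intro mult_mono) auto
    then show ?thesis by (simp add: abs_mult algebra_simps)
  qed
  have "\<bar>LINT x|lebesgue_on U. g x * \<phi> x\<bar> \<le> (LINT x|lebesgue_on U. \<bar>g x * \<phi> x\<bar>)"
    by (rule integral_abs_bound)
  also have "\<dots> \<le> (LINT x|lebesgue_on U. l * indicator S x + l powr (1 - p) * (\<bar>g x\<bar> powr p * indicator S x))"
    using int intp intS pt by (intro integral_mono) auto
  also have "\<dots> = l * measure lborel S + l powr (1 - p) * (LINT x|lebesgue_on U. \<bar>g x\<bar> powr p * indicator S x)"
    using intp intS mS S(2) SU by (simp add: inf_absorb1 space_restrict_space)
  finally show ?thesis .
qed

section \<open>Frames adapted to convex sets and the upper bound\<close>

text \<open>Orthonormal bases of \<open>S\<close> and of its orthogonal complement are matched with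
  the index type by an arbitrary bijection. As the indices carry no order, the coordinates spanning
  \<open>S\<close> are recorded as a set \<open>I\<close> instead of the first few.\<close>

lemma orthogonal_frame_adapted:
  fixes S :: "(real^'n) set"
  assumes S: "subspace S"
  obtains Q :: "real^'n \<Rightarrow> real^'n" and I :: "'n set"
  where "orthogonal_transformation Q" "card I = dim S" "\<And>i. i \<in> I \<Longrightarrow> Q (axis i 1) \<in> S"
proof -
  define S' where "S' = {y \<in> UNIV. \<forall>x\<in>S. orthogonal x y}"
  have S': "subspace S'" unfolding S'_def
    by (simp add: subspace_orthogonal_to_vectors)
  have dim: "dim S' + dim S = CARD('n)"
    using dim_subspace_orthogonal_to_vectors[OF S subspace_UNIV] by (simp add: S'_def)
  obtain B where B: "B \<subseteq> S" "pairwise orthogonal B" "\<And>x. x \<in> B \<Longrightarrow> norm x = 1"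
      "independent B" "card B = dim S"
    using orthonormal_basis_subspace[OF S] by metis
  obtain B' where B': "B' \<subseteq> S'" "pairwise orthogonal B'" "\<And>x. x \<in> B' \<Longrightarrow> norm x = 1"
      "independent B'" "card B' = dim S'"
    using orthonormal_basis_subspace[OF S'] by metis
  have fin: "finite B" "finite B'" using B(4) B'(4) independent_imp_finite by blast+
  have orth: "orthogonal x y" if "x \<in> B" "y \<in> B'" for x y
    using that B(1) B'(1) unfolding S'_def by blast
  have disj: "B \<inter> B' = {}"
  proof (rule ccontr)
    assume "B \<inter> B' \<noteq> {}"
    then obtain x where x: "x \<in> B" "x \<in> B'" by blast
    then have "x = 0" using orth[of x x] by (simp add: orthogonal_def)
    with B(3) x show False by force
  qed
  have "card (B \<union> B') = CARD('n)"
    using card_Un_disjoint[OF fin disj] B(5) B'(5) dim by simp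
  then obtain g where g: "bij_betw g (UNIV :: 'n set) (B \<union> B')"
    by (metis finite_same_card_bij finite_UnI fin finite_class.finite_UNIV)
  have gi: "g i \<in> B \<union> B'" for i using g by (auto simp: bij_betw_def)
  have gg: "g i \<bullet> g j = (if i = j then 1 else 0)" for i j
  proof (cases "i = j")
    case True
    have "norm (g i) = 1" using gi[of i] B(3) B'(3) by blast
    with True show ?thesis by (simp add: norm_eq_1)
  next
    case False
    then have ne: "g i \<noteq> g j" using g by (auto simp: bij_betw_def inj_on_def)
    have "orthogonal (g i) (g j)"
      using gi[of i] gi[of j] ne B(2) B'(2) orth unfolding pairwise_def
      by (metis Un_iff orthogonal_commute)
    with False show ?thesis by (simp add: orthogonal_def)
  qed
  define Q where "Q x = (\<Sum>i\<in>UNIV. (x $ i) *\<^sub>R g i)" for x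
  have Qa: "Q (axis i 1) = g i" for i
    unfolding Q_def axis_def by (subst sum.remove[of _ i]) auto
  have "linear Q" unfolding Q_def
    by (rule linearI) (simp_all add: scaleR_left_distrib sum.distrib scaleR_sum_right)
  moreover have "Q v \<bullet> Q w = v \<bullet> w" for v w
  proof -
    have "Q v \<bullet> Q w = (\<Sum>i\<in>UNIV. \<Sum>j\<in>UNIV. v $ i * w $ j * (g i \<bullet> g j))"
      unfolding Q_def by (simp add: inner_sum_left inner_sum_right sum_distrib_left mult_ac) (rule sum.swap)
    also have "\<dots> = v \<bullet> w"
      unfolding gg by (simp add: inner_vec_def if_distrib cong: if_cong)
    finally show ?thesis .
  qed
  ultimately have "orthogonal_transformation Q" by (simp add: orthogonal_transformation_def)
  moreover have "card {i. g i \<in> B} = dim S"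
  proof -
    have "g ` {i. g i \<in> B} = B" using g by (auto simp: bij_betw_def)
    moreover have "inj_on g {i. g i \<in> B}" using g by (auto simp: bij_betw_def inj_on_def)
    ultimately show ?thesis using card_image B(5) by metis
  qed
  ultimately show ?thesis using that[of Q "{i. g i \<in> B}"] B(1) by (auto simp: Qa)
qed

text \<open>Around a relative interior point, \<open>Z\<close> contains a ball of its affine hull.
  Exactly \<open>k\<close> of its directions are kept, even if \<open>Z\<close> has larger
  dimension, because the exponents are tuned to \<open>k\<close>.\<close>

lemma convex_set_adapted_frame:
  fixes Z :: "(real^'n) set"
  assumes Z: "convex Z" "Z \<subseteq> U" "open U" and k: "int k \<le> aff_dim Z"
  obtains c :: "real^'n" and Q :: "real^'n \<Rightarrow> real^'n" and I :: "'n set" and \<epsilon> :: real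
  where "orthogonal_transformation Q" "card I = k" "\<epsilon> > 0"
    "\<And>y. norm y \<le> \<epsilon> \<Longrightarrow> c + Q y \<in> U"
    "\<And>y. norm y \<le> \<epsilon> \<Longrightarrow> (\<And>i. i \<notin> I \<Longrightarrow> y $ i = 0) \<Longrightarrow> c + Q y \<in> Z"
proof -
  \<comment> \<open>The empty set has affine dimension -1.\<close>
  have "Z \<noteq> {}" using k by auto
  then obtain c where c: "c \<in> rel_interior Z" using rel_interior_eq_empty[OF Z(1)] by blast
  then obtain e where e: "c \<in> Z" "e > 0" "cball c e \<inter> affine hull Z \<subseteq> Z"
    using mem_rel_interior_cball by blast
  obtain e' where e': "e' > 0" "cball c e' \<subseteq> U"
    using Z e(1) open_contains_cball by blast
  let ?V = "(\<lambda>x. - c + x) ` Z"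
  have ch: "c \<in> affine hull Z" using e(1) by (simp add: hull_inc)
  have "k \<le> dim ?V" using aff_dim_eq_dim[OF ch] k by simp
  then obtain S where S: "subspace S" "S \<subseteq> span ?V" "dim S = k"
    by (rule choose_subspace_of_subspace)
  obtain Q :: "real^'n \<Rightarrow> real^'n" and I :: "'n set" where Q: "orthogonal_transformation Q" and I: "card I = dim S"
      "\<And>i. i \<in> I \<Longrightarrow> Q (axis i 1) \<in> S"
    using orthogonal_frame_adapted[OF S(1)] by blast
  interpret Q: linear Q using Q by (rule orthogonal_transformation_linear)
  have n: "norm (Q y) = norm y" for y using Q by (simp add: orthogonal_transformation_norm)
  have "c + Q y \<in> Z" if y: "norm y \<le> min e e'" "\<And>i. i \<notin> I \<Longrightarrow> y $ i = 0" for y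
  proof -
    have "Q y = (\<Sum>i\<in>UNIV. (y $ i) *\<^sub>R Q (axis i 1))"
      using basis_expansion[of y] by (metis (no_types, lifting) Q.scale Q.sum scalar_mult_eq_scaleR sum.cong)
    also have "\<dots> \<in> S"
    proof (intro subspace_sum[OF S(1)])
      fix i show "(y $ i) *\<^sub>R Q (axis i 1) \<in> S"
        using I(2)[of i] y(2)[of i] S(1) by (cases "i \<in> I") (auto simp: subspace_scale subspace_0)
    qed
    finally have "Q y \<in> span ?V" using S(2) by blast
    then have "c + Q y \<in> affine hull Z" using affine_hull_span_gen[OF ch] by blast
    moreover have "c + Q y \<in> cball c e" using y n by (simp add: dist_norm)
    ultimately show ?thesis using e(3) by blast
  qed
  moreover have "c + Q y \<in> U" if "norm y \<le> min e e'" for y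
  proof -
    have "c + Q y \<in> cball c e'" using that n by (simp add: dist_norm)
    then show ?thesis using e'(2) by blast
  qed
  ultimately show ?thesis using that[of Q I "min e e'" c] Q I(1) S(3) e(2) e'(1) by simp
qed

section \<open>Upper bound through the weak Hessian\<close>

lemma orthogonal_component_le_1:
  fixes Q :: "real^'n \<Rightarrow> real^'n"
  assumes "orthogonal_transformation Q"
  shows "\<bar>Q (axis m 1) $ i\<bar> \<le> 1"
  using component_le_norm_cart[of "Q (axis m 1)" i] assms
  by (simp add: orthogonal_transformation_norm)

text \<open>The left side is the integral of u against the Laplacian of \<open>cyl_test\<close> in
  the directions outside \<open>I\<close>. Weak differentiability moves it onto the entries
  \<open>h i j\<close>, each estimated at the truncation level \<open>l\<close>, which stays free
  until the scale r is chosen.\<close>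

lemma weak_laplacian_upper_bound:
  fixes u :: "real^'n \<Rightarrow> real" and I :: "'n set" and Q :: "real^'n \<Rightarrow> real^'n" and c :: "real^'n" and \<rho> r l p :: real
  defines "S \<equiv> (\<lambda>y. c + Q y) ` cylinder I \<rho> r"
  assumes Q: "orthogonal_transformation Q" and \<rho>: "\<rho> > 0" and r: "r > 0"
    and U: "open U" and SU: "S \<subseteq> U" and cu: "continuous_on U u"
    and w: "\<And>i. weak_partial U i u (g i)" "\<And>i j. weak_partial U j (g i) (h i j)"
    and Lp: "\<And>i j. Lp p U (h i j)" and p: "p \<ge> 1" and l: "l > 0"
  shows "2 / r\<^sup>2 * (\<integral>y. indicator (cylinder I \<rho> r) y * u (c + Q y) *
        (bump 0 (cylfun I \<rho> y) * (2 * (1 - cylfun (-I) r y) * bump 2 (cylfun (-I) r y)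
           - real (card (- I)) * bump 1 (cylfun (-I) r y))) \<partial>lborel)
    \<le> real (card (- I)) * (\<Sum>i\<in>UNIV. \<Sum>j\<in>UNIV. l * measure lborel S
         + l powr (1 - p) * (LINT x|lebesgue_on U. \<bar>h i j x\<bar> powr p * indicator S x))"
proof -
  let ?A = "\<lambda>y. c + Q y"
  define \<Phi> where "\<Phi> = cyl_test I \<rho> r Q c"
  define y where "y = coords Q c"
  define D1 where "D1 m x = bump 0 (cylfun I \<rho> (y x)) * (bump 1 (cylfun (- I) r (y x)) * (- 2 * y x $ m / r\<^sup>2))" for m x
  define D2 where "D2 m x = bump 0 (cylfun I \<rho> (y x)) * (bump 2 (cylfun (- I) r (y x)) * (4 * (y x $ m)\<^sup>2 / r ^ 4)
       - bump 1 (cylfun (- I) r (y x)) * (2 / r\<^sup>2))" for m x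
  define m1 where "m1 z = bump 0 (cylfun I \<rho> z) * (2 * (1 - cylfun (-I) r z) * bump 2 (cylfun (-I) r z)
           - real (card (- I)) * bump 1 (cylfun (-I) r z))" for z :: "real^'n"
  define E where "E = (\<Sum>i\<in>UNIV. \<Sum>j\<in>UNIV. l * measure lborel S
         + l powr (1 - p) * (LINT x|lebesgue_on U. \<bar>h i j x\<bar> powr p * indicator S x))"
  have cA: "continuous_on X ?A" for X
    by (intro continuous_intros continuous_on_orthogonal_transformation Q)
  have cS: "compact S" unfolding S_def by (intro compact_continuous_image cA compact_cylinder \<rho> r)
  have UL: "U \<in> sets lebesgue" using U by simp
  have t: "test_fun U \<Phi>" unfolding \<Phi>_def
    by (rule test_fun_cyl_test[OF Q \<rho> r]) (use SU in \<open>simp add: S_def\<close>)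
  have \<Phi>: "\<bar>\<Phi> x\<bar> \<le> indicator S x" for x
    using cyl_test_bounds[of I \<rho> r Q c x] cyl_test_zero[OF Q, of x c I \<rho> r]
    by (auto simp: \<Phi>_def S_def indicator_def)
  have bd: "\<bar>LINT x|lebesgue_on U. h i j x * \<Phi> x\<bar> \<le> l * measure lborel S
         + l powr (1 - p) * (LINT x|lebesgue_on U. \<bar>h i j x\<bar> powr p * indicator S x)" for i j
    using weak_second_partial(2)[OF w t]
    by (intro Lp_truncated_bound[OF Lp p l UL cS SU \<Phi>])
  have dd: "frechet_derivative \<Phi> (at x) (Q (axis m 1)) = D1 m x"
    "frechet_derivative (D1 m) (at x) (Q (axis m 1)) = D2 m x" if "m \<in> - I" for m x
    using cyl_test_derivatives[OF Q, where j=m and I=I and \<rho>=\<rho> and r=r and c=c and x=x] that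
    by (simp_all add: \<Phi>_def D1_def[abs_def] D2_def y_def)
  have dir: "integrable (lebesgue_on U) (\<lambda>x. u x * D2 m x)"
    "(LINT x|lebesgue_on U. u x * D2 m x) \<le> E" if m: "m \<in> - I" for m
  proof -
    note wd = weak_second_directional[OF w t dd[OF m]]
    show "integrable (lebesgue_on U) (\<lambda>x. u x * D2 m x)" by (rule wd(1))
    have "(LINT x|lebesgue_on U. u x * D2 m x) = (\<Sum>i\<in>UNIV. \<Sum>j\<in>UNIV.
        Q (axis m 1) $ i * Q (axis m 1) $ j * (LINT x|lebesgue_on U. h i j x * \<Phi> x))"
      by (rule wd(2))
    also have "\<dots> \<le> E" unfolding E_def
    proof (intro sum_mono)
      fix i j
      have "Q (axis m 1) $ i * Q (axis m 1) $ j * (LINT x|lebesgue_on U. h i j x * \<Phi> x)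
          \<le> \<bar>Q (axis m 1) $ i\<bar> * \<bar>Q (axis m 1) $ j\<bar> * \<bar>LINT x|lebesgue_on U. h i j x * \<Phi> x\<bar>"
        unfolding abs_mult[symmetric] by (rule abs_ge_self)
      also have "\<dots> \<le> (1 * 1) * \<bar>LINT x|lebesgue_on U. h i j x * \<Phi> x\<bar>"
        by (intro mult_right_mono mult_mono orthogonal_component_le_1[OF Q]) auto
      finally show "Q (axis m 1) $ i * Q (axis m 1) $ j * (LINT x|lebesgue_on U. h i j x * \<Phi> x)
          \<le> l * measure lborel S
         + l powr (1 - p) * (LINT x|lebesgue_on U. \<bar>h i j x\<bar> powr p * indicator S x)"
        using bd[of i j] by simp
    qed
    finally show "(LINT x|lebesgue_on U. u x * D2 m x) \<le> E" .
  qed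
  \<comment> \<open>The sum of the squares \<open>(y x $ m)\<^sup>2\<close> is r^2 times
    \<open>1 - cylfun (-I) r (y x)\<close>, so one power of r^2 cancels and the common factor 2 /
    r^2 comes out.\<close>
  have lap: "(\<Sum>m\<in>-I. D2 m x) = 2 / r\<^sup>2 * m1 (y x)" for x
  proof -
    have q: "(\<Sum>m\<in>-I. (y x $ m)\<^sup>2) = r\<^sup>2 * (1 - cylfun (-I) r (y x))"
      using r by (simp add: cylfun_def)
    have "(\<Sum>m\<in>-I. D2 m x) = bump 0 (cylfun I \<rho> (y x)) *
       (bump 2 (cylfun (- I) r (y x)) * (4 * (\<Sum>m\<in>-I. (y x $ m)\<^sup>2) / r ^ 4)
         - real (card (-I)) * (bump 1 (cylfun (- I) r (y x)) * (2 / r\<^sup>2)))"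
      unfolding D2_def
      by (simp add: sum_distrib_left[symmetric] sum_subtractf sum_divide_distrib[symmetric])
    also have "\<dots> = 2 / r\<^sup>2 * m1 (y x)"
      unfolding q m1_def using r by (simp add: field_simps power2_eq_square power4_eq_xxxx)
    finally show ?thesis .
  qed
  define F where "F z = indicator (cylinder I \<rho> r) z * u (c + Q z) * m1 z" for z
  have m1z: "m1 z = 0" if "z \<notin> cylinder I \<rho> r" for z
    using that by (auto simp: m1_def cylinder_def bump_eq_0)
  have Fm: "F \<in> borel_measurable borel"
  proof -
    have "(\<lambda>z. indicator (cylinder I \<rho> r) z *\<^sub>R u (c + Q z)) \<in> borel_measurable borel"
      by (intro borel_measurable_continuous_on_indicator cylinder_borel continuous_on_compose2[OF cu] cA)
         (use SU S_def in auto)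
    then show ?thesis unfolding F_def[abs_def] m1_def by simp
  qed
  have ym: "y \<in> borel_measurable borel"
    unfolding y_def coords_def[abs_def]
    by (intro borel_measurable_continuous_onI continuous_on_vec_lambda continuous_intros)
  \<comment> \<open>Both sides vanish off the image of the cylinder, which lies in \<open>U\<close>.
    The integral over \<open>U\<close> is thereby one over the whole space and can be carried back
    by the isometry.\<close>
  have e: "indicator U x * (u x * m1 (y x)) = F (y x)" for x
  proof (cases "y x \<in> cylinder I \<rho> r")
    case True
    have x: "c + Q (y x) = x" unfolding y_def by (rule coords_isometry[OF Q])
    then have "x \<in> U" using SU True by (force simp: S_def)
    with True x show ?thesis by (simp add: F_def)
  qed (simp add: F_def m1z)
  have "(LINT x|lebesgue_on U. u x * m1 (y x)) = (LINT x|lebesgue. indicator U x *\<^sub>R (u x * m1 (y x)))"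
    using UL by (simp add: integral_restrict_space)
  also have "\<dots> = (LINT x|lebesgue. F (y x))" using e by simp
  also have "\<dots> = (LINT x|lborel. F (y x))"
    by (rule integral_completion) (use measurable_compose[OF ym Fm] in simp)
  also have "\<dots> = (LINT x|distr lborel borel ?A. F (y x))"
    by (simp add: lborel_distr_isometry[OF Q])
  also have "\<dots> = (LINT z|lborel. F (y (?A z)))"
    by (rule integral_distr) (use cA measurable_compose[OF ym Fm] in \<open>auto intro!: borel_measurable_continuous_onI\<close>)
  also have "\<dots> = (LINT z|lborel. F z)" by (simp add: y_def coords_isometry[OF Q])
  finally have cv: "(LINT x|lebesgue_on U. u x * m1 (y x)) = integral\<^sup>L lborel F" .
  have "2 / r\<^sup>2 * integral\<^sup>L lborel F = (LINT x|lebesgue_on U. 2 / r\<^sup>2 * (u x * m1 (y x)))"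
    using cv by simp
  also have "\<dots> = (LINT x|lebesgue_on U. (\<Sum>m\<in>-I. u x * D2 m x))"
    by (intro Bochner_Integration.integral_cong refl)
       (simp only: sum_distrib_left[symmetric] lap, simp add: mult_ac)
  also have "\<dots> = (\<Sum>m\<in>-I. LINT x|lebesgue_on U. u x * D2 m x)"
    by (rule Bochner_Integration.integral_sum) (rule dir(1))
  also have "\<dots> \<le> (\<Sum>m\<in>-I. E)" by (intro sum_mono dir(2))
  finally show ?thesis by (simp add: F_def[abs_def] m1_def E_def)
qed

text \<open>The constant is exp(-1/t) at t = 3/4, and \<open>bump 1 t\<close> equals exp(-1/t) /
  t^2, which is no smaller than exp(-1/t) for t at most 1.\<close>

lemma bump_lower_bounds:
  assumes "3 / 4 \<le> t" "t \<le> 1"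
  shows "exp (- (4 / 3)) \<le> bump 0 t" "exp (- (4 / 3)) \<le> bump 1 t"
proof -
  have e: "exp (- (4 / 3)) \<le> exp (- (1 / t))" using assms by (simp add: field_simps)
  then show "exp (- (4 / 3)) \<le> bump 0 t" using assms by (simp add: bump_def)
  have "1 \<le> 1 / t" using assms by simp
  then have "1 * 1 \<le> 1 / t * (1 / t)" using assms by (intro mult_mono) auto
  then have "1 * exp (- (4 / 3)) \<le> (1 / t * (1 / t)) * exp (- (1 / t))"
    using e by (intro mult_mono) auto
  then show "exp (- (4 / 3)) \<le> bump 1 t" using assms by (simp add: bump_def pderiv_1 power2_eq_square)
qed

section \<open>Growth estimate and conclusion\<close>

text \<open>The two bounds on the integral of u minus the affine function meet here: from below by
  the Monge-Ampere inequality on an inscribed box, from above by the dilation inequality and the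
  weak Hessian on the cylinder. Both r and l remain free.\<close>

lemma flat_growth_estimate:
  fixes u :: "real^'n \<Rightarrow> real" and I :: "'n set" and Q :: "real^'n \<Rightarrow> real^'n"
    and a c :: "real^'n" and b \<rho> r l p :: real
  defines "S \<equiv> (\<lambda>y. c + Q y) ` cylinder I \<rho> r"
    and "T \<equiv> (\<Prod>i\<in>UNIV. (if i \<in> I then \<rho> else r) / (2 * real CARD('n)))"
  assumes Q: "orthogonal_transformation Q" and r: "0 < r" "r \<le> \<rho>"
    and U: "open U" and conv: "convex_on U u" and MA: "MA_ge_one U u"
    and supp: "\<And>x. x \<in> U \<Longrightarrow> a \<bullet> x + b \<le> u x"
    and inU: "\<And>y. norm y \<le> 2 * \<rho> \<Longrightarrow> c + Q y \<in> U"
    and flat: "\<And>y. norm y \<le> 2 * \<rho> \<Longrightarrow> (\<And>i. i \<notin> I \<Longrightarrow> y $ i = 0) \<Longrightarrow> u (c + Q y) = a \<bullet> (c + Q y) + b"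
    and w: "\<And>i. weak_partial U i u (g i)" "\<And>i j. weak_partial U j (g i) (h i j)"
    and Lp: "\<And>i j. Lp p U (h i j)" and p: "p \<ge> 1" and l: "l > 0"
  shows "(exp (- (4 / 3)))\<^sup>2 * T powr (1 + 2 / real CARD('n))
    \<le> 2 ^ (CARD('n) + 4) * (r\<^sup>2 / 2 * (real (card (- I)) * (\<Sum>i\<in>UNIV. \<Sum>j\<in>UNIV. l * measure lborel S
         + l powr (1 - p) * (LINT x|lebesgue_on U. \<bar>h i j x\<bar> powr p * indicator S x))))"
proof -
  let ?A = "\<lambda>y. c + Q y" and ?n = "CARD('n)" and ?E = "cylinder I \<rho> r"
  have \<rho>: "\<rho> > 0" using r by simp
  interpret Q: linear Q using Q by (rule orthogonal_transformation_linear)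
  have Qi: "Q x \<bullet> Q y = x \<bullet> y" for x y using Q by (simp add: orthogonal_transformation_def)
  have cu: "continuous_on U u" by (rule convex_on_continuous[OF U conv])
  have cA: "continuous_on X ?A" for X
    by (intro continuous_intros continuous_on_orthogonal_transformation Q)
  have EU: "?A y \<in> U" if "y \<in> ?E" for y using cylinder_norm_le[OF that \<rho> r] by (rule inU)
  have SU: "S \<subseteq> U" using EU by (auto simp: S_def)
  have cuA: "continuous_on ?E (\<lambda>y. u (?A y))"
    by (rule continuous_on_compose2[OF cu cA]) (use EU in auto)
  obtain a' where a': "a = Q a'" using orthogonal_transformation_surj[OF Q] by (metis surjD)
  define d where "d = a \<bullet> c + b"
  have lin: "a \<bullet> (c + Q y) + b = a' \<bullet> y + d" for y
    by (simp add: d_def inner_add_right a' Qi)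
  define f where "f y = indicator ?E y * u (?A y)" for y
  define \<eta> where "\<eta> y = bump 0 (cylfun I \<rho> y) * bump 1 (cylfun (-I) r y)" for y :: "real^'n"
  define v where "v y = u (?A y) - (a \<bullet> (?A y) + b)" for y
  have v0: "v y \<ge> 0" if "y \<in> ?E" for y using supp[OF EU[OF that]] by (simp add: v_def)
  have \<eta>0: "\<eta> y \<ge> 0" for y by (simp add: \<eta>_def bump_0_nonneg bump_1_nonneg[unfolded One_nat_def])
  \<comment> \<open>The divisor 2n puts the box where both defining functions are at least 3/4: at
    most n squares, each at most (t / (2n))^2, sum to at most t^2 / 4.\<close>
  define \<tau> :: "real^'n" where "\<tau> = (\<chi> i. (if i \<in> I then \<rho> else r) / (2 * real ?n))"
  have n: "real ?n \<ge> 1" by simp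
  have \<tau>: "\<tau> $ i > 0" for i using \<rho> r n by (simp add: \<tau>_def)
  have T: "T = (\<Prod>i\<in>UNIV. \<tau> $ i)" by (simp add: T_def \<tau>_def)
  have T0: "T > 0" unfolding T using \<tau> by (intro prod_pos) auto
  define B where "B = cbox (- \<tau>) \<tau>"
  have quarter: "cylfun J t y \<ge> 3 / 4"
    if y: "y \<in> B" and J: "\<And>i. i \<in> J \<Longrightarrow> \<tau> $ i = t / (2 * real ?n)" and t: "t > 0" for y J t
  proof -
    have "(\<Sum>i\<in>J. (y $ i)\<^sup>2) \<le> (\<Sum>i\<in>J. (t / (2 * real ?n))\<^sup>2)"
    proof (rule sum_mono)
      fix i assume i: "i \<in> J"
      have "\<bar>y $ i\<bar> \<le> \<tau> $ i" using y[unfolded B_def mem_box_cart, rule_format, of i] by (simp add: abs_le_iff)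
      then show "(y $ i)\<^sup>2 \<le> (t / (2 * real ?n))\<^sup>2" using J[OF i] by (metis abs_ge_zero power2_abs power_mono)
    qed
    also have "\<dots> = real (card J) * (t / (2 * real ?n))\<^sup>2" by simp
    also have "\<dots> \<le> real ?n * (t / (2 * real ?n))\<^sup>2"
      by (intro mult_right_mono) (auto simp: card_mono)
    also have "\<dots> = t\<^sup>2 / (4 * real ?n)" by (simp add: power2_eq_square field_simps)
    also have "\<dots> \<le> t\<^sup>2 / 4" using n t by (simp add: divide_simps)
    finally show ?thesis using t by (simp add: cylfun_def field_simps)
  qed
  have B1: "cylfun I \<rho> y \<ge> 3 / 4" "cylfun (-I) r y \<ge> 3 / 4" if "y \<in> B" for y
    using quarter[OF that, of I \<rho>] quarter[OF that, of "-I" r] \<rho> r by (auto simp: \<tau>_def)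
  have BE: "B \<subseteq> ?E" using B1 by (fastforce simp: cylinder_def)
  define J where "J = (\<integral>y. indicator B y * v y \<partial>lborel)"
  have MAJ: "T ^ (?n + 2) \<le> (2 ^ (?n + 4) * J) ^ ?n"
    unfolding T J_def B_def v_def
    by (rule MA_lower_bound[OF Q MA \<tau> _ cu supp]) (use BE EU in \<open>auto simp: B_def\<close>)
  have J0: "J \<ge> 0" unfolding J_def
    by (intro Bochner_Integration.integral_nonneg) (use v0 BE in \<open>auto simp: indicator_def\<close>)
  \<comment> \<open>The n-th root of \<open>MAJ\<close>.\<close>
  have TJ: "T powr (1 + 2 / real ?n) \<le> 2 ^ (?n + 4) * J"
  proof (rule power_le_imp_le_base[of _ "?n - 1"])
    have "(T powr (1 + 2 / real ?n)) ^ ?n = T powr (real ?n * (1 + 2 / real ?n))"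
      using T0 by (simp add: powr_powr powr_realpow[symmetric] mult.commute)
    also have "real ?n * (1 + 2 / real ?n) = real (?n + 2)" by (simp add: field_simps)
    also have "T powr real (?n + 2) = T ^ (?n + 2)" using T0 by (rule powr_realpow)
    finally show "(T powr (1 + 2 / real ?n)) ^ Suc (?n - 1) \<le> (2 ^ (?n + 4) * J) ^ Suc (?n - 1)"
      using MAJ by simp
    show "0 \<le> 2 ^ (?n + 4) * J" using J0 by simp
  qed
  have cv: "continuous_on ?E v" unfolding v_def by (intro continuous_intros cuA cA)
  have c\<eta>: "continuous_on X \<eta>" for X unfolding \<eta>_def by (intro continuous_intros)
  have intE: "integrable lborel (\<lambda>y. indicator ?E y * (v y * \<eta> y))"
    using borel_integrable_compact[OF compact_cylinder[OF \<rho> r(1)] continuous_on_mult[OF cv c\<eta>]] by simp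
  have intB: "integrable lborel (\<lambda>y. indicator B y * v y)"
    using borel_integrable_compact[of B v] continuous_on_subset[OF cv BE] by (simp add: B_def compact_cbox)
  have "(exp (- (4 / 3)))\<^sup>2 * J = (\<integral>y. (exp (- (4 / 3)))\<^sup>2 * (indicator B y * v y) \<partial>lborel)"
    by (simp add: J_def)
  also have "\<dots> \<le> (\<integral>y. indicator ?E y * (v y * \<eta> y) \<partial>lborel)"
  proof (rule integral_mono[OF _ intE])
    show "integrable lborel (\<lambda>y. (exp (- (4 / 3)))\<^sup>2 * (indicator B y * v y))"
      using intB by (rule integrable_mult_right)
    fix y :: "real^'n"
    show "(exp (- (4 / 3)))\<^sup>2 * (indicator B y * v y) \<le> indicator ?E y * (v y * \<eta> y)"
    proof (cases "y \<in> B")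
      case True
      have "exp (- (4 / 3)) * exp (- (4 / 3)) \<le> \<eta> y" unfolding \<eta>_def
        by (intro mult_mono bump_lower_bounds B1 True cylfun_le_1 bump_0_nonneg) simp
      then have "v y * (exp (- (4 / 3)))\<^sup>2 \<le> v y * \<eta> y"
        using True BE v0 by (intro mult_left_mono) (auto simp: power2_eq_square)
      then show ?thesis using True BE by (auto simp: mult.commute)
    next
      case False
      then show ?thesis using v0[of y] \<eta>0[of y] by (auto simp: indicator_def)
    qed
  qed
  also have "\<dots> = (\<integral>y. (f y - (a' \<bullet> y + d)) * \<eta> y \<partial>lborel)"
  proof (intro Bochner_Integration.integral_cong refl)
    fix y :: "real^'n"
    show "indicator ?E y * (v y * \<eta> y) = (f y - (a' \<bullet> y + d)) * \<eta> y"
      using bump_product_zero[of y I \<rho> r 0 1] by (cases "y \<in> ?E") (auto simp: f_def v_def lin \<eta>_def)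
  qed
  also have "\<dots> \<le> (\<integral>x. f x * (bump 0 (cylfun I \<rho> x) * (2 * (1 - cylfun (-I) r x) * bump 2 (cylfun (-I) r x)
           - real (card (-I)) * bump 1 (cylfun (-I) r x))) \<partial>lborel)"
  proof -
    have "compact ((\<lambda>y. u (?A y)) ` ?E)"
      by (intro compact_continuous_image cuA compact_cylinder \<rho> r)
    then obtain M where M: "M > 0" "\<forall>z\<in>(\<lambda>y. u (?A y)) ` ?E. norm z \<le> M"
      by (meson bounded_pos compact_imp_bounded)
    show ?thesis unfolding \<eta>_def
    proof (rule dilation_inequality[OF \<rho> r(1), of f M])
      have "(\<lambda>y. indicator ?E y *\<^sub>R u (?A y)) \<in> borel_measurable borel"
        by (intro borel_measurable_continuous_on_indicator cylinder_borel cuA)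
      then show "f \<in> borel_measurable borel" by (simp add: f_def[abs_def])
      show "\<bar>f x\<bar> \<le> M" for x using M by (auto simp: f_def indicator_def)
      show "f x = 0" if "x \<notin> ?E" for x using that by (simp add: f_def)
      fix x s assume x: "x \<in> ?E" and s: "0 < s" "s < (1::real)"
      \<comment> \<open>Convexity is applied on the segment from x to its projection
        \<open>dil I 0 x\<close>, where u coincides with the affine function.\<close>
      have d0: "dil I 0 x \<in> ?E" and ds: "dil I s x \<in> ?E" using dil_cylinder[OF x] s by auto
      have dec: "dil I s x = s *\<^sub>R x + (1 - s) *\<^sub>R dil I 0 x"
        by (simp add: vec_eq_iff dil_nth algebra_simps)
      have "?A (dil I s x) = s *\<^sub>R ?A x + (1 - s) *\<^sub>R ?A (dil I 0 x)"
      proof -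
        have "Q (dil I s x) = s *\<^sub>R Q x + (1 - s) *\<^sub>R Q (dil I 0 x)"
          unfolding dec Q.add Q.scale ..
        then show ?thesis by (simp add: algebra_simps)
      qed
      moreover have "u ((1 - s) *\<^sub>R ?A (dil I 0 x) + s *\<^sub>R ?A x) \<le> (1 - s) * u (?A (dil I 0 x)) + s * u (?A x)"
        using s by (intro convex_onD[OF conv] EU x d0) auto
      moreover have "u (?A (dil I 0 x)) = a' \<bullet> dil I 0 x + d"
      proof -
        have "u (?A (dil I 0 x)) = a \<bullet> (?A (dil I 0 x)) + b"
          by (intro flat cylinder_norm_le[OF d0 \<rho> r]) (simp add: dil_nth)
        then show ?thesis by (simp only: lin)
      qed
      ultimately show "f (dil I s x) \<le> s * f x + (1 - s) * (a' \<bullet> dil I 0 x + d)"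
        using x ds by (simp add: f_def add.commute)
    qed
  qed
  also have "\<dots> \<le> r\<^sup>2 / 2 * (real (card (- I)) * (\<Sum>i\<in>UNIV. \<Sum>j\<in>UNIV. l * measure lborel S
         + l powr (1 - p) * (LINT x|lebesgue_on U. \<bar>h i j x\<bar> powr p * indicator S x)))"
    (is "?X \<le> _ * ?Y")
  proof -
    have "2 / r\<^sup>2 * ?X \<le> ?Y" unfolding S_def f_def
      by (rule weak_laplacian_upper_bound[OF Q \<rho> r(1) U _ cu w Lp p l]) (use SU in \<open>simp add: S_def\<close>)
    then have "r\<^sup>2 / 2 * (2 / r\<^sup>2 * ?X) \<le> r\<^sup>2 / 2 * ?Y" by (intro mult_left_mono) auto
    then show ?thesis using r by simp
  qed
  finally have "(exp (- (4 / 3)))\<^sup>2 * J \<le> r\<^sup>2 / 2 * ?Y" .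
  then have "2 ^ (?n + 4) * ((exp (- (4 / 3)))\<^sup>2 * J) \<le> 2 ^ (?n + 4) * (r\<^sup>2 / 2 * ?Y)"
    by (rule mult_left_mono) simp
  moreover have "(exp (- (4 / 3)))\<^sup>2 * T powr (1 + 2 / real ?n) \<le> (exp (- (4 / 3)))\<^sup>2 * (2 ^ (?n + 4) * J)"
    by (rule mult_left_mono[OF TJ]) simp
  ultimately show ?thesis by (simp only: mult.left_commute)
qed

lemma measure_cylinder_image_le:
  fixes Q :: "real^'n \<Rightarrow> real^'n" and I :: "'n set"
  assumes Q: "orthogonal_transformation Q" and r: "\<rho> > 0" "r > 0"
  shows "measure lborel ((\<lambda>y. c + Q y) ` cylinder I \<rho> r) \<le> 2 ^ CARD('n) * \<rho> ^ card I * r ^ card (- I)"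
proof -
  define \<tau> :: "real^'n" where "\<tau> = (\<chi> i. if i \<in> I then \<rho> else r)"
  have m: "- \<tau> = (\<chi> i. - (if i \<in> I then \<rho> else r))" by (simp add: \<tau>_def vec_eq_iff)
  have "measure lborel ((\<lambda>y. c + Q y) ` cylinder I \<rho> r) = measure lborel (cylinder I \<rho> r)"
    using emeasure_isometry_image[OF Q compact_cylinder[OF r]] by (simp add: measure_def)
  also have "\<dots> \<le> measure lborel (cbox (- \<tau>) \<tau>)"
    using cylinder_subset_cbox[OF r, of I] unfolding m unfolding \<tau>_def
    by (intro measure_mono_fmeasurable) (auto simp: cylinder_borel)
  also have "\<dots> = (\<Prod>i\<in>UNIV. \<tau> $ i - (- \<tau>) $ i)"
    by (rule content_cbox_cart_le) (use r in \<open>simp add: \<tau>_def\<close>)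
  also have "\<dots> = (\<Prod>i\<in>UNIV. 2 * (if i \<in> I then \<rho> else r))"
    by (intro prod.cong) (auto simp: \<tau>_def)
  also have "\<dots> = 2 ^ CARD('n) * \<rho> ^ card I * r ^ card (- I)"
    by (simp add: prod.distrib prod.If_cases)
  finally show ?thesis .
qed

text \<open>A point whose m-th coordinate in the frame is nonzero leaves the cylinders eventually,
  and the remaining points form a null hyperplane. Dominated convergence does the rest, so a single
  index outside \<open>I\<close> is enough.\<close>

lemma integral_shrinking_cylinders:
  fixes Q :: "real^'n \<Rightarrow> real^'n" and I :: "'n set" and G :: "real^'n \<Rightarrow> real"
  assumes Q: "orthogonal_transformation Q" and \<rho>: "\<rho> > 0" and R: "R > 0" and m: "m \<notin> I"
    and U: "open U" and G: "integrable (lebesgue_on U) G" "\<And>x. G x \<ge> 0"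
  shows "(\<lambda>j. LINT x|lebesgue_on U. G x * indicator ((\<lambda>y. c + Q y) ` cylinder I \<rho> (R / real (Suc j))) x) \<longlonglongrightarrow> 0"
proof -
  let ?S = "\<lambda>j. (\<lambda>y. c + Q y) ` cylinder I \<rho> (R / real (Suc j))"
  have Rj: "R / real (Suc j) > 0" for j using R by simp
  have UL: "U \<in> sets lebesgue" using U by simp
  have Sb: "?S j \<in> sets borel" for j
    by (intro borel_compact compact_continuous_image compact_cylinder \<rho> Rj continuous_intros
        continuous_on_orthogonal_transformation Q)
  have "(\<lambda>j. LINT x|lebesgue_on U. G x * indicator (?S j) x) \<longlonglongrightarrow> (LINT x|lebesgue_on U. 0)"
  proof (rule integral_dominated_convergence[OF _ _ G(1)])
    show "(\<lambda>x. G x * indicator (?S j) x) \<in> borel_measurable (lebesgue_on U)" for j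
    proof (rule borel_measurable_times)
      show "G \<in> borel_measurable (lebesgue_on U)" using G(1) by auto
      have "indicat_real (?S j) \<in> borel_measurable lebesgue"
        using Sb[of j] by (intro borel_measurable_indicator sets_completionI_sets) simp
      then show "indicat_real (?S j) \<in> borel_measurable (lebesgue_on U)"
        by (rule measurable_restrict_space1)
    qed
    show "AE x in lebesgue_on U. norm (G x * indicator (?S j) x) \<le> G x" for j
      using G(2) by (auto simp: indicator_def)
    let ?b = "Q (axis m 1)"
    have "?b \<noteq> 0" using orthogonal_transformation_norm[OF Q, of "axis m 1"] by force
    then have "negligible {x. ?b \<bullet> x = ?b \<bullet> c}" by (intro negligible_hyperplane) simp
    then have "AE x in lebesgue. x \<notin> {x. ?b \<bullet> x = ?b \<bullet> c}"
      by (intro AE_not_in) (simp add: negligible_iff_null_sets)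
    then have "AE x in lebesgue_on U. ?b \<bullet> x \<noteq> ?b \<bullet> c"
      using UL by (subst AE_restrict_space_iff) (auto elim: eventually_mono)
    then show "AE x in lebesgue_on U. (\<lambda>j. G x * indicator (?S j) x) \<longlonglongrightarrow> 0"
    proof (rule eventually_mono)
      fix x assume x: "?b \<bullet> x \<noteq> ?b \<bullet> c"
      define t where "t = \<bar>coords Q c x $ m\<bar>"
      have t: "t > 0" using x by (simp add: t_def coords_def inner_diff_right)
      have "(\<lambda>j. R * (1 / real (Suc j))) \<longlonglongrightarrow> R * 0"
        by (intro tendsto_intros LIMSEQ_Suc[OF lim_1_over_n])
      then have "\<forall>\<^sub>F j in sequentially. R / real (Suc j) < t"
        using t by (intro order_tendstoD(2)[of _ 0]) auto
      then have "\<forall>\<^sub>F j in sequentially. G x * indicator (?S j) x = 0"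
      proof (rule eventually_mono)
        fix j assume j: "R / real (Suc j) < t"
        have "x \<notin> ?S j"
        proof
          assume "x \<in> ?S j"
          then obtain y where y: "x = c + Q y" "y \<in> cylinder I \<rho> (R / real (Suc j))" by auto
          have "t \<le> R / real (Suc j)"
            using cylinder_nth_le[OF y(2) \<rho> Rj, of m] m by (simp add: t_def y(1) coords_isometry[OF Q])
          with j show False by simp
        qed
        then show "G x * indicator (?S j) x = 0" by simp
      qed
      then show "(\<lambda>j. G x * indicator (?S j) x) \<longlonglongrightarrow> 0" by (rule tendsto_eventually)
    qed
  qed simp
  then show ?thesis by simp
qed

text \<open>Put q = 2k/n, so that the truncation level is \<delta> r^(-q). Since N (1 + 2/n) = 2 + N
  - q, the left side and the volume term both carry the power R = r^(2 + N - q). The remaining term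
  carries r^(2 - q + q p), which is at most R because r \<le> 1 and q p \<ge> N; this last condition
  is the assumed lower bound on p. Dividing by R removes r altogether.\<close>

lemma critical_scaling:
  fixes r \<delta> p :: real and n k N :: nat
  assumes r: "0 < r" "r \<le> 1" and \<delta>: "\<delta> > 0" and n: "n = k + N" "0 < n"
    and p: "real N \<le> 2 * real k / real n * p"
    and e: "e \<ge> 0" and c: "C\<^sub>4 \<ge> 0"
    and le: "c\<^sub>2 * (r ^ N) powr (1 + 2 / real n) \<le> r\<^sup>2 * (C\<^sub>3 * (\<delta> * r powr (- (2 * real k / real n))) * r ^ N
        + C\<^sub>4 * ((\<delta> * r powr (- (2 * real k / real n))) powr (1 - p) * e))"
  shows "c\<^sub>2 \<le> C\<^sub>3 * \<delta> + C\<^sub>4 * (\<delta> powr (1 - p) * e)"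
proof -
  define q where "q = 2 * real k / real n"
  define R where "R = r powr (2 + real N - q)"
  have R: "R > 0" using r by (simp add: R_def)
  have rN: "r ^ N = r powr real N" and r2: "r\<^sup>2 = r powr 2"
    using r by (simp_all add: powr_realpow)
  have ex: "real N * (1 + 2 / real n) = 2 + real N - q"
  proof -
    have "real N * 2 / real n + q = (real N * 2 + 2 * real k) / real n"
      by (simp add: q_def add_divide_distrib)
    also have "real N * 2 + 2 * real k = 2 * real n" using n by simp
    also have "2 * real n / real n = 2" using n(2) by simp
    finally show ?thesis by (simp add: distrib_left)
  qed
  have 1: "(r ^ N) powr (1 + 2 / real n) = R"
    unfolding rN R_def powr_powr ex ..
  have 2: "r\<^sup>2 * (\<delta> * r powr (- q)) * r ^ N = \<delta> * R"
    unfolding rN r2 R_def using r by (simp add: powr_add[symmetric] powr_diff powr_minus field_simps powr_add)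
  have 3: "r\<^sup>2 * (\<delta> * r powr (- q)) powr (1 - p) \<le> \<delta> powr (1 - p) * R"
  proof -
    have "r\<^sup>2 * (\<delta> * r powr (- q)) powr (1 - p) = \<delta> powr (1 - p) * r powr (2 + - q * (1 - p))"
      by (simp only: r2 powr_mult powr_powr powr_add mult.left_commute)
    also have "r powr (2 + - q * (1 - p)) \<le> R" unfolding R_def
    proof (rule powr_mono')
      have "real N \<le> q * p" using p by (simp add: q_def)
      then show "2 + real N - q \<le> 2 + - q * (1 - p)" by (simp add: algebra_simps)
    qed (use r in auto)
    finally show ?thesis by (simp add: mult_left_mono)
  qed
  have "c\<^sub>2 * R \<le> C\<^sub>3 * (r\<^sup>2 * (\<delta> * r powr (- q)) * r ^ N) + C\<^sub>4 * e * (r\<^sup>2 * (\<delta> * r powr (- q)) powr (1 - p))"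
    using le unfolding 1 q_def[symmetric] by (simp add: algebra_simps)
  also have "\<dots> \<le> C\<^sub>3 * (\<delta> * R) + C\<^sub>4 * e * (\<delta> powr (1 - p) * R)"
    unfolding 2 by (intro add_left_mono mult_left_mono 3) (use e c in simp)
  also have "\<dots> = (C\<^sub>3 * \<delta> + C\<^sub>4 * (\<delta> powr (1 - p) * e)) * R" by (simp add: algebra_simps)
  finally show ?thesis using R by simp
qed

theorem theorem1p1:
  fixes u :: "real^'n \<Rightarrow> real" and k :: nat and p :: real
  assumes conv: "convex_on (ball 0 1) u"
    and MA: "MA_ge_one (ball 0 1) u"
    and k: "0 < k" "2 * k < CARD('n)"
    and p: "p \<ge> real CARD('n) / (2 * real k) * (real CARD('n) - real k)"
    and sob: "W2p p (ball 0 1) u"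
  shows "\<forall>x0 \<in> ball 0 1. \<forall>(a :: real^'n) (b :: real).
           ((\<forall>x\<in>ball 0 1. a \<bullet> x + b \<le> u x) \<and> a \<bullet> x0 + b = u x0) \<longrightarrow>
           aff_dim {x \<in> ball 0 1. u x = a \<bullet> x + b} \<le> int k - 1"
proof (intro ballI allI impI, rule ccontr)
  fix x0 a :: "real^'n" and b :: real
  let ?U = "ball (0::real^'n) 1" and ?n = "CARD('n)"
  assume supp: "(\<forall>x\<in>?U. a \<bullet> x + b \<le> u x) \<and> a \<bullet> x0 + b = u x0"
  define Z where "Z = {x \<in> ?U. u x = a \<bullet> x + b}"
  assume "\<not> aff_dim {x \<in> ?U. u x = a \<bullet> x + b} \<le> int k - 1"
  then have kZ: "int k \<le> aff_dim Z" by (simp add: Z_def)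
  have "convex Z"
  proof (rule convexI)
    fix x y and s t :: real
    assume xy: "x \<in> Z" "y \<in> Z" and st: "0 \<le> s" "0 \<le> t" "s + t = 1"
    have U: "s *\<^sub>R x + t *\<^sub>R y \<in> ?U"
      using xy st convexD[OF convex_ball, of x 0 1 y s t] by (simp add: Z_def)
    have "u (s *\<^sub>R x + t *\<^sub>R y) \<le> s * u x + t * u y"
      using conv xy st unfolding convex_on_def Z_def by blast
    also have "\<dots> = a \<bullet> (s *\<^sub>R x + t *\<^sub>R y) + (s + t) * b"
      using xy by (simp add: Z_def inner_add_right algebra_simps)
    finally show "s *\<^sub>R x + t *\<^sub>R y \<in> Z" using U st supp by (force simp: Z_def)
  qed
  moreover have "Z \<subseteq> ?U" by (auto simp: Z_def)
  ultimately obtain c and Q :: "real^'n \<Rightarrow> real^'n" and I :: "'n set" and \<epsilon>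
    where Q: "orthogonal_transformation Q" and I: "card I = k" and \<epsilon>: "\<epsilon> > 0"
      and inU: "\<And>y. norm y \<le> \<epsilon> \<Longrightarrow> c + Q y \<in> ?U"
      and inZ: "\<And>y. norm y \<le> \<epsilon> \<Longrightarrow> (\<And>i. i \<notin> I \<Longrightarrow> y $ i = 0) \<Longrightarrow> c + Q y \<in> Z"
    using convex_set_adapted_frame[of Z ?U k, OF _ _ open_ball kZ] by metis
  \<comment> \<open>A cylinder with r \<le> \<rho> lies in the ball of radius 2 \<rho>, which must
    stay within \<epsilon>.\<close>
  define \<rho> where "\<rho> = \<epsilon> / 2"
  have \<rho>: "\<rho> > 0" "\<epsilon> = 2 * \<rho>" using \<epsilon> by (auto simp: \<rho>_def)
  define N where "N = card (- I)"
  have nk: "?n = k + N" using card_Un_disjoint[of I "- I"] I by (simp add: N_def Compl_partition)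
  have n0: "0 < ?n" by simp
  have N: "N > k" using nk k by simp
  obtain m where m: "m \<notin> I" using N by (metis N_def UNIV_I card.empty compl_top_eq not_less_zero UNIV_eq_I)
  obtain g h where w: "\<And>i. weak_partial ?U i u (g i)" "\<And>i j. weak_partial ?U j (g i) (h i j)"
    and Lp: "\<And>i j. Lp p ?U (h i j)"
    using sob unfolding W2p_def by blast
  have pN: "real N \<le> 2 * real k / real ?n * p"
  proof -
    have "2 * real k / real ?n * (real ?n / (2 * real k) * (real ?n - real k)) \<le> 2 * real k / real ?n * p"
      using p by (intro mult_left_mono) auto
    then show ?thesis using k nk by simp
  qed
  \<comment> \<open>Since 2k < n, the factor 2k/n is at most 1, so \<open>pN\<close> gives p \<ge> N
    \<ge> 1; the truncation argument relies on 1 - p \<le> 0.\<close>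
  have p1: "p \<ge> 1"
  proof -
    have "real N \<le> real N * p"
    proof -
      have "0 \<le> p" using pN k N n0 by (smt (verit) divide_nonneg_nonneg mult_nonneg_nonpos of_nat_0_le_iff of_nat_0_less_iff less_trans)
      have "2 * real k / real ?n \<le> 1" using k by simp
      then have "2 * real k / real ?n * p \<le> 1 * p" using \<open>0 \<le> p\<close> by (rule mult_right_mono)
      then have "real N \<le> p" using pN by simp
      moreover have "1 \<le> real N" using N by simp
      ultimately show ?thesis using mult_mono[of 1 "real N" "real N" p] by (smt (verit) mult_left_mono)
    qed
    then show ?thesis using N by simp
  qed
  define S where "S r = (\<lambda>y. c + Q y) ` cylinder I \<rho> r" for r
  define e where "e r = (\<Sum>i\<in>UNIV. \<Sum>j\<in>UNIV. LINT x|lebesgue_on ?U. \<bar>h i j x\<bar> powr p * indicator (S r) x)" for r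
  define \<kappa> :: real where "\<kappa> = (exp (- (4 / 3)))\<^sup>2"
  \<comment> \<open>\<open>c2\<close> is the part of the lower bound free of r. \<open>C4\<close>
    collects the factors 2^(n + 4), 1/2 and the N directions; \<open>C3\<close> adds the n^2 Hessian
    entries and the volume bound \<open>2 ^ ?n * \<rho> ^ k\<close> per unit of
    \<open>r ^ N\<close>.\<close>
  define c2 where "c2 = \<kappa> * (\<rho> ^ k / (2 * real ?n) ^ ?n) powr (1 + 2 / real ?n)"
  define C4 where "C4 = 2 ^ (?n + 4) * (real N / 2)"
  define C3 where "C3 = C4 * (real ?n * real ?n * (2 ^ ?n * \<rho> ^ k))"
  have e0: "e r \<ge> 0" for r unfolding e_def
    by (intro sum_nonneg Bochner_Integration.integral_nonneg) auto
  have C4: "C4 > 0" using N by (simp add: C4_def)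
  have C3: "C3 > 0" using C4 \<rho> by (simp add: C3_def)
  have c2: "c2 > 0" using \<rho> by (simp add: c2_def \<kappa>_def)
  \<comment> \<open>This choice makes the volume term exactly half of \<open>c2\<close>; the other
    half has to be beaten by the vanishing mass \<open>e r\<close>.\<close>
  define \<delta> where "\<delta> = c2 / (2 * C3)"
  have \<delta>: "\<delta> > 0" using c2 C3 by (simp add: \<delta>_def)
  have main: "c2 \<le> C3 * \<delta> + C4 * (\<delta> powr (1 - p) * e r)" if r: "0 < r" "r \<le> \<rho>" "r \<le> 1" for r
  proof (rule critical_scaling[OF r(1,3) \<delta> nk n0 pN e0 less_imp_le[OF C4]])
    define l where "l = \<delta> * r powr (- (2 * real k / real ?n))"
    have l: "l > 0" using \<delta> r by (simp add: l_def)
    define T where "T = (\<Prod>i\<in>(UNIV :: 'n set). (if i \<in> I then \<rho> else r) / (2 * real ?n))"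
    have T: "T = \<rho> ^ k / (2 * real ?n) ^ ?n * r ^ N"
      by (simp add: T_def prod_dividef prod.If_cases I N_def)
    have "c2 * (r ^ N) powr (1 + 2 / real ?n) = \<kappa> * T powr (1 + 2 / real ?n)"
      unfolding c2_def T by (simp only: powr_mult mult.assoc)
    also have "\<dots> \<le> 2 ^ (?n + 4) * (r\<^sup>2 / 2 * (real N * (\<Sum>i\<in>(UNIV :: 'n set). \<Sum>j\<in>(UNIV :: 'n set). l * measure lborel (S r)
         + l powr (1 - p) * (LINT x|lebesgue_on ?U. \<bar>h i j x\<bar> powr p * indicator (S r) x))))"
      unfolding \<kappa>_def T_def N_def S_def
    proof (rule flat_growth_estimate[OF Q r(1,2) open_ball conv MA _ _ _ w Lp p1 l])
      show "a \<bullet> x + b \<le> u x" if "x \<in> ?U" for x using supp that by blast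
      show "c + Q y \<in> ?U" if "norm y \<le> 2 * \<rho>" for y using inU that \<rho> by simp
      show "u (c + Q y) = a \<bullet> (c + Q y) + b" if "norm y \<le> 2 * \<rho>" "\<And>i. i \<notin> I \<Longrightarrow> y $ i = 0" for y
        using inZ[of y] that \<rho> by (simp add: Z_def)
    qed
    also have "\<dots> = C4 * r\<^sup>2 * (real ?n * real ?n * (l * measure lborel (S r)) + l powr (1 - p) * e r)"
      by (simp add: C4_def e_def sum.distrib sum_distrib_left[symmetric] algebra_simps)
    also have "\<dots> \<le> C4 * r\<^sup>2 * (real ?n * real ?n * (l * (2 ^ ?n * \<rho> ^ k * r ^ N)) + l powr (1 - p) * e r)"
      using measure_cylinder_image_le[OF Q \<rho>(1) r(1), of c I] C4 l
      by (intro mult_left_mono add_right_mono) (auto simp: S_def I N_def)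
    also have "\<dots> = r\<^sup>2 * (C3 * l * r ^ N + C4 * (l powr (1 - p) * e r))"
      by (simp add: C3_def algebra_simps)
    finally show "c2 * (r ^ N) powr (1 + 2 / real ?n) \<le> r\<^sup>2 * (C3 * (\<delta> * r powr (- (2 * real k / real ?n))) * r ^ N
        + C4 * ((\<delta> * r powr (- (2 * real k / real ?n))) powr (1 - p) * e r))"
      unfolding l_def .
  qed
  \<comment> \<open>Radii at most \<rho> keep the cylinders inside the ball, and radii at most 1 are
    required by \<open>critical_scaling\<close>.\<close>
  define R where "R = min \<rho> 1"
  have R: "R > 0" "R \<le> \<rho>" "R \<le> 1" using \<rho> by (auto simp: R_def)
  have "(\<lambda>j. e (R / real (Suc j))) \<longlonglongrightarrow> (\<Sum>i\<in>(UNIV :: 'n set). \<Sum>j\<in>(UNIV :: 'n set). 0)"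
    unfolding e_def S_def
    by (intro tendsto_sum integral_shrinking_cylinders[OF Q \<rho>(1) R(1) m open_ball])
      (use Lp in \<open>auto simp: Lp_def\<close>)
  then have "(\<lambda>j. C3 * \<delta> + C4 * (\<delta> powr (1 - p) * e (R / real (Suc j)))) \<longlonglongrightarrow> C3 * \<delta> + C4 * (\<delta> powr (1 - p) * 0)"
    by (intro tendsto_intros) simp
  moreover have "c2 \<le> C3 * \<delta> + C4 * (\<delta> powr (1 - p) * e (R / real (Suc j)))" for j
  proof (rule main)
    have "R / real (Suc j) \<le> R" using R by (simp add: divide_le_eq)
    then show "R / real (Suc j) \<le> \<rho>" "R / real (Suc j) \<le> 1" using R by auto
  qed (use R in simp)
  ultimately have "c2 \<le> C3 * \<delta> + C4 * (\<delta> powr (1 - p) * 0)"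
    by (intro LIMSEQ_le_const) auto
  \<comment> \<open>The limit inequality reads c2 \<le> c2 / 2 with c2 > 0.\<close>
  then show False using C3 c2 by (simp add: \<delta>_def)
qed

end
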